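(* Let $d\ge 1$ be a constant. Given a set of $n$ trajectories in $\mathbb{R}^d$, each with vertices at times $t_0,\dots,t_\tau$, and $\varepsilon>0$, a central trajectory has worst-case complexity $O(\tau n^{5/2})$.
   Context: Setting: $\mathcal{X}$ is a set of $n$ entities, each moving in $\mathbb{R}^d$ along a piecewise-linear trajectory $\sigma:[t_0,t_\tau]\to\mathbb{R}^d$ with vertices at the common times $t_0<\dots<t_\tau$; trajectories are in general position (no three trajectories pass through the same point at the same time, and no two pairs of entities are at distance exactly $\varepsilon$ at the same time). Two entities $\sigma,\psi$ are $\varepsilon$-connected at time $t$ if there is a sequence $\sigma=\sigma_0,\dots,\sigma_k=\psi$ with $\|\sigma_j(t)\sigma_{j+1}(t)\|\le\varepsilon$ for all $j$ (Euclidean distance). A trajectoid is a function $\mathcal{T}:[t_0,t_\tau]\to\mathcal{X}$ such that whenever $\mathcal{T}$ is discontinuous at time $t$, switching from $\sigma$ to $\psi$, then $\sigma,\psi$ are $\varepsilon$-connected at time $t$. $D(\sigma,t)=\max_{\psi\in\mathcal{X}}\|\sigma(t)\psi(t)\|$. A central trajectory is a trajectoid minimizing $\int_{t_0}^{t_\tau}D(\mathcal{T}(t),t)\,dt$. The complexity of a trajectoid is the number of pieces of the curve $t\mapsto\mathcal{T}(t)(t)$, i.e. the number of maximal time intervals on which $\mathcal{T}$ is a single entity and that entity moves linearly. *)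

theory Defs
  imports "HOL-Analysis.Analysis"
begin

text \<open>Entities are indices i < n; X i is the trajectory of entity i.
  The time domain is [t0, t1] where t0 = tm 0 and t1 = tm tau.\<close>

definition piecewise_linear_trajs ::
  "nat \<Rightarrow> nat \<Rightarrow> (nat \<Rightarrow> real) \<Rightarrow> (nat \<Rightarrow> real \<Rightarrow> 'a::real_vector) \<Rightarrow> bool" where
  "piecewise_linear_trajs n tau tm X \<longleftrightarrow>
     (\<forall>i<n. \<forall>j<tau. \<exists>a b. \<forall>s\<in>{tm j..tm (Suc j)}. X i s = a + s *\<^sub>R b)"

definition eps_connected ::
  "nat \<Rightarrow> (nat \<Rightarrow> real \<Rightarrow> 'a::metric_space) \<Rightarrow> real \<Rightarrow> real \<Rightarrow> nat \<Rightarrow> nat \<Rightarrow> bool" where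
  "eps_connected n X eps t i j \<longleftrightarrow>
     (\<lambda>a b. a < n \<and> b < n \<and> dist (X a t) (X b t) \<le> eps)\<^sup>*\<^sup>* i j"

definition general_position ::
  "nat \<Rightarrow> (nat \<Rightarrow> real \<Rightarrow> 'a::metric_space) \<Rightarrow> real \<Rightarrow> real \<Rightarrow> real \<Rightarrow> bool" where
  "general_position n X eps t0 t1 \<longleftrightarrow>
     (\<forall>t\<in>{t0..t1}. \<forall>i<n. \<forall>j<n. \<forall>k<n.
        i \<noteq> j \<and> j \<noteq> k \<and> i \<noteq> k \<longrightarrow> \<not> (X i t = X j t \<and> X j t = X k t)) \<and>
     (\<forall>t\<in>{t0..t1}. \<forall>i<n. \<forall>j<n. \<forall>k<n. \<forall>l<n.
        i \<noteq> j \<and> k \<noteq> l \<and> {i, j} \<noteq> {k, l} \<longrightarrow>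
        \<not> (dist (X i t) (X j t) = eps \<and> dist (X k t) (X l t) = eps))"

text \<open>A trajectoid: whenever a value psi is attained arbitrarily close to t
  (i.e. T switches between T t and psi at t), T t and psi are eps-connected at t.\<close>
definition trajectoid ::
  "nat \<Rightarrow> (nat \<Rightarrow> real \<Rightarrow> 'a::metric_space) \<Rightarrow> real \<Rightarrow> real \<Rightarrow> real \<Rightarrow> (real \<Rightarrow> nat) \<Rightarrow> bool" where
  "trajectoid n X eps t0 t1 T \<longleftrightarrow>
     (\<forall>t\<in>{t0..t1}. T t < n) \<and>
     (\<forall>t\<in>{t0..t1}. \<forall>psi.
        (\<forall>\<delta>>0. \<exists>s\<in>{t0..t1}. \<bar>s - t\<bar> < \<delta> \<and> T s = psi) \<longrightarrow>
        eps_connected n X eps t (T t) psi)"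

definition Dmax :: "nat \<Rightarrow> (nat \<Rightarrow> real \<Rightarrow> 'a::metric_space) \<Rightarrow> nat \<Rightarrow> real \<Rightarrow> real" where
  "Dmax n X i t = Max ((\<lambda>j. dist (X i t) (X j t)) ` {..<n})"

definition central_trajectory ::
  "nat \<Rightarrow> (nat \<Rightarrow> real \<Rightarrow> 'a::metric_space) \<Rightarrow> real \<Rightarrow> real \<Rightarrow> real \<Rightarrow> (real \<Rightarrow> nat) \<Rightarrow> bool" where
  "central_trajectory n X eps t0 t1 T \<longleftrightarrow>
     trajectoid n X eps t0 t1 T \<and>
     (\<lambda>t. Dmax n X (T t) t) integrable_on {t0..t1} \<and>
     (\<forall>T'. trajectoid n X eps t0 t1 T' \<and> (\<lambda>t. Dmax n X (T' t) t) integrable_on {t0..t1} \<longrightarrow>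
        integral {t0..t1} (\<lambda>t. Dmax n X (T t) t) \<le> integral {t0..t1} (\<lambda>t. Dmax n X (T' t) t))"

definition complexity_le ::
  "(nat \<Rightarrow> real \<Rightarrow> 'a::real_vector) \<Rightarrow> real \<Rightarrow> real \<Rightarrow> (real \<Rightarrow> nat) \<Rightarrow> nat \<Rightarrow> bool" where
  "complexity_le X t0 t1 T m \<longleftrightarrow>
     (\<exists>s e. s 0 = t0 \<and> s m = t1 \<and> (\<forall>i<m. s i < s (Suc i)) \<and>
        (\<forall>i<m. \<forall>t\<in>{s i<..<s (Suc i)}. T t = e i) \<and>
        (\<forall>i<m. \<exists>a b. \<forall>t\<in>{s i..s (Suc i)}. X (e i) t = a + t *\<^sub>R b) \<and>
        T (s 0) = e 0 \<and> T (s m) = e (m - 1) \<and>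
        (\<forall>i. 0 < i \<and> i < m \<longrightarrow> T (s i) = e (i - 1) \<or> T (s i) = e i))"

end

theory Submission
  imports Defs
begin

text \<open>
  Cut time at the trajectory vertices, at the times where some pair of entities enters or leaves
  distance \<open>\<epsilon>\<close>, and at the breakpoints of every \<open>D\<^sub>i\<close>; since \<open>D\<^sub>i\<^sup>2\<close> is an upper envelope of quadratics
  with \<open>O(\<tau>n)\<close> pieces, this gives \<open>O(\<tau>n\<^sup>2)\<close> windows. Inside a window a trajectoid stays in one
  \<open>\<epsilon>\<close>-component, so it is optimal to follow the lower envelope of the \<open>D\<^sub>i\<close> in that component. Only
  finitely many sequences of components are possible, whence a minimiser exists.

  If \<open>d\<close> entities are needed for the envelope in a window, it has at most \<open>2d\<close> breakpoints there, and
  each of the \<open>d(d-1)/2\<close> pairs crosses in that window. A pair crosses \<open>O(\<tau>n)\<close> times in total, so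
  the sum of \<open>d(d-1)\<close> over all windows is \<open>O(\<tau>n\<^sup>3)\<close>, and by Cauchy-Schwarz over the \<open>O(\<tau>n\<^sup>2)\<close>
  windows the sum of \<open>d\<close> is \<open>O(\<tau>n\<^bsup>5/2\<^esup>)\<close>.
\<close>

section \<open>Gaps of a finite set of reals\<close>

text \<open>Windows are kept as a set of pairs of consecutive cut points, so that sums and choices
  can be indexed by them directly; an ordered list is produced only when the pieces of a trajectoid
  are enumerated.\<close>

definition gaps :: "real set \<Rightarrow> (real \<times> real) set" where
  "gaps B = {(u, v). u \<in> B \<and> v \<in> B \<and> u < v \<and> B \<inter> {u<..<v} = {}}"

lemma gapsD:
  assumes "(u, v) \<in> gaps B"
  shows "u \<in> B" "v \<in> B" "u < v" "B \<inter> {u<..<v} = {}"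
  using assms by (auto simp: gaps_def)

lemma gaps_unique_fst: "(u, v) \<in> gaps B \<Longrightarrow> (u, v') \<in> gaps B \<Longrightarrow> v = v'"
  unfolding gaps_def by (auto, metis disjoint_iff greaterThanLessThan_iff linorder_neqE)

lemma gaps_overlap:
  assumes "(u, v) \<in> gaps B" "(u', v') \<in> gaps B" "t \<in> {u<..<v}" "t \<in> {u'<..<v'}"
  shows "(u, v) = (u', v')"
proof -
  have "\<not> u < u'" "\<not> u' < u"
    using gapsD[OF assms(1)] gapsD[OF assms(2)] assms(3,4) by (force simp: disjoint_iff)+
  then have "u = u'" by simp
  then show ?thesis using gaps_unique_fst assms(1,2) by blast
qed

text \<open>At a switching time the old and the new entity may belong to different windows. This
  reduces that situation to a common cut point of two neighbouring windows.\<close>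

lemma gaps_touch:
  assumes "(u, v) \<in> gaps B" "(u', v') \<in> gaps B" "t \<in> {u..v}" "t \<in> {u'..v'}"
  shows "(u, v) = (u', v') \<or> t = v \<and> t = u' \<or> t = u \<and> t = v'"
proof -
  have lt: "u < v" "u' < v'" using gapsD(3) assms(1,2) by auto
  have "u \<notin> {u'<..<v'}" "v \<notin> {u'<..<v'}" "u' \<notin> {u<..<v}" "v' \<notin> {u<..<v}"
    using gapsD[OF assms(1)] gapsD[OF assms(2)] by blast+
  then consider "u = u'" "v = v'" | "v = u'" | "u = v'" | "v < u'" | "v' < u"
    using lt by (force simp: not_less)
  then show ?thesis using assms(3,4) by cases auto
qed

text \<open>The left endpoint identifies the gap, so \<open>fst\<close> embeds the gaps into
  \<open>B\<close>.\<close>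

lemma
  assumes "finite B"
  shows finite_gaps: "finite (gaps B)" and card_gaps_le: "card (gaps B) \<le> card B"
proof -
  have inj: "inj_on fst (gaps B)"
    by (rule inj_onI) (use gaps_unique_fst in \<open>fastforce\<close>)
  have sub: "fst ` gaps B \<subseteq> B" by (auto simp: gaps_def)
  show "finite (gaps B)"
    using finite_imageD[OF finite_subset[OF sub assms] inj] .
  show "card (gaps B) \<le> card B"
    using card_inj_on_le[OF inj sub assms] .
qed

lemma gap_containing:
  assumes "finite B" "a \<in> B" "b \<in> B" "a \<le> x" "x < y" "y \<le> b" "B \<inter> {x<..<y} = {}"
  obtains u v where "(u, v) \<in> gaps B" "u \<le> x" "y \<le> v"
proof
  let ?L = "{z \<in> B. z \<le> x}" and ?R = "{z \<in> B. y \<le> z}"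
  have L: "finite ?L" "?L \<noteq> {}" and R: "finite ?R" "?R \<noteq> {}" using assms by auto
  have "Max ?L \<in> ?L" "Min ?R \<in> ?R" using Max_in[OF L] Min_in[OF R] by auto
  moreover have "z \<notin> {Max ?L<..<Min ?R}" if "z \<in> B" for z
  proof (cases "z \<le> x")
    case True
    then show ?thesis using Max_ge[OF L(1), of z] that by auto
  next
    case False
    then have "y \<le> z" using assms(7) that by (force simp: disjoint_iff)
    then show ?thesis using Min_le[OF R(1), of z] that by auto
  qed
  ultimately show "(Max ?L, Min ?R) \<in> gaps B" "Max ?L \<le> x" "y \<le> Min ?R"
    using assms(5) by (auto simp: gaps_def)
qed

text \<open>Distinct gaps are disjoint as open intervals, so each point of \<open>Z\<close> is
  counted at most once. This is how a bound on all crossings of a pair becomes a bound summed over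
  windows.\<close>

lemma sum_card_gaps_Int_le:
  assumes "finite B" "finite Z"
  shows "(\<Sum>(u, v)\<in>gaps B. card (Z \<inter> {u<..<v})) \<le> card Z"
proof -
  have "(\<Sum>(u, v)\<in>gaps B. card (Z \<inter> {u<..<v})) = (\<Sum>g\<in>gaps B. card (Z \<inter> {fst g<..<snd g}))"
    by (simp add: case_prod_unfold)
  also have "\<dots> = card (\<Union>g\<in>gaps B. Z \<inter> {fst g<..<snd g})"
  proof (rule card_UN_disjoint[symmetric])
    show "finite (gaps B)" using assms finite_gaps by blast
    show "\<forall>g\<in>gaps B. finite (Z \<inter> {fst g<..<snd g})" using assms by auto
    show "\<forall>g\<in>gaps B. \<forall>h\<in>gaps B. g \<noteq> h \<longrightarrow>
        (Z \<inter> {fst g<..<snd g}) \<inter> (Z \<inter> {fst h<..<snd h}) = {}"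
    proof (intro ballI impI)
      fix g h assume "g \<in> gaps B" "h \<in> gaps B" "g \<noteq> h"
      then show "(Z \<inter> {fst g<..<snd g}) \<inter> (Z \<inter> {fst h<..<snd h}) = {}"
        using gaps_overlap[of "fst g" "snd g" B "fst h" "snd h"]
        by (simp add: disjoint_iff) blast
    qed
  qed
  also have "\<dots> \<le> card Z" using assms(2) by (intro card_mono) auto
  finally show ?thesis .
qed

lemma gaps_enumerate:
  assumes "finite B" "a \<in> B" "b \<in> B" "a < b" "B \<subseteq> {a..b}"
  obtains s :: "nat \<Rightarrow> real" and m where "s 0 = a" "s m = b" "m < card B"
    "\<And>i. i < m \<Longrightarrow> (s i, s (Suc i)) \<in> gaps B"
proof -
  define l where "l = sorted_list_of_set B"
  have l: "set l = B" "distinct l" "sorted l" "length l = card B"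
    using assms(1) by (auto simp: l_def)
  have sm: "sorted_wrt (<) l" using l by (simp add: strict_sorted_iff)
  have ne: "card B > 0" using assms by (auto simp: card_gt_0_iff)
  have lt: "l ! i < l ! j" if "i < j" "j < card B" for i j
    using sm that l(4) by (simp add: sorted_wrt_iff_nth_less)
  have memB: "l ! i \<in> B" if "i < card B" for i using that l by auto
  have idx: "\<exists>i<card B. l ! i = x" if "x \<in> B" for x using that l by (metis in_set_conv_nth)
  show thesis
  proof (rule that[of "\<lambda>i. l ! i" "card B - 1"])
    obtain i where i: "i < card B" "l ! i = a" using idx assms(2) by blast
    show "l ! 0 = a"
      using lt[of 0 i] i memB[of 0] ne assms(5) by (cases "i = 0") auto
    obtain j where j: "j < card B" "l ! j = b" using idx assms(3) by blast
    show "l ! (card B - 1) = b"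
      using lt[of j "card B - 1"] j memB[of "card B - 1"] ne assms(5)
      by (cases "j = card B - 1") (force simp: subset_iff)+
    show "card B - 1 < card B" using ne by simp
    fix i assume i: "i < card B - 1"
    have "l ! k \<notin> {l ! i<..<l ! Suc i}" if k: "k < card B" for k
    proof (cases "k \<le> i")
      case True then show ?thesis using lt[of k i] i by (cases "k = i") fastforce+
    next
      case False then show ?thesis using lt[of "Suc i" k] k by (cases "k = Suc i") auto
    qed
    then have "B \<inter> {l ! i<..<l ! Suc i} = {}" using idx by blast
    then show "(l ! i, l ! Suc i) \<in> gaps B"
      using i lt[of i "Suc i"] memB by (auto simp: gaps_def)
  qed
qed

section \<open>Envelopes of quadratic functions\<close>

text \<open>Vanishing leading coefficients are allowed, which keeps the class closed under
  differences and lets it contain the constant zero.\<close>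

definition quadratic_on :: "real set \<Rightarrow> (real \<Rightarrow> real) \<Rightarrow> bool" where
  "quadratic_on S f \<longleftrightarrow> (\<exists>a b c. \<forall>t\<in>S. f t = a * t\<^sup>2 + b * t + c)"

lemma quadratic_on_subset: "quadratic_on S f \<Longrightarrow> R \<subseteq> S \<Longrightarrow> quadratic_on R f"
  unfolding quadratic_on_def by blast

lemma quadratic_on_diff:
  assumes "quadratic_on S f" "quadratic_on S g"
  shows "quadratic_on S (\<lambda>t. f t - g t)"
proof -
  obtain a b c a' b' c' where "\<forall>t\<in>S. f t = a * t\<^sup>2 + b * t + c" "\<forall>t\<in>S. g t = a' * t\<^sup>2 + b' * t + c'"
    using assms unfolding quadratic_on_def by metis
  then have "\<forall>t\<in>S. f t - g t = (a - a') * t\<^sup>2 + (b - b') * t + (c - c')"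
    by (simp add: algebra_simps)
  then show ?thesis unfolding quadratic_on_def by blast
qed

lemma quadratic_on_zero: "quadratic_on S (\<lambda>_. 0)"
  unfolding quadratic_on_def by (intro exI[of _ 0]) simp

lemma quadratic_on_uminus: "quadratic_on S f \<Longrightarrow> quadratic_on S (\<lambda>t. - f t)"
  using quadratic_on_diff[OF quadratic_on_zero, of S f] by simp

text \<open>If \<open>I\<close> is unbounded below or above then the corresponding exceptional point is junk, which
  is harmless.\<close>

lemma is_interval_exceptional:
  fixes I :: "real set"
  assumes "is_interval I" "{x<..<y} \<inter> {Inf I, Sup I} = {}"
  shows "{x<..<y} \<subseteq> I \<or> {x<..<y} \<inter> I = {}"
proof (rule ccontr)
  assume "\<not> ?thesis"
  then obtain p q where p: "p \<in> {x<..<y}" "p \<in> I" and q: "q \<in> {x<..<y}" "q \<notin> I" by blast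
  have conv: "\<And>r s z. r \<in> I \<Longrightarrow> s \<in> I \<Longrightarrow> r \<le> z \<Longrightarrow> z \<le> s \<Longrightarrow> z \<in> I"
    using assms(1) unfolding is_interval_1 by blast
  show False
  proof (cases "q < p")
    case True
    then have lb: "\<And>z. z \<in> I \<Longrightarrow> q \<le> z" using conv p q by (meson linear order_less_imp_le)
    then have "q \<le> Inf I" "Inf I \<le> p"
      using p by (auto intro!: cInf_greatest cInf_lower bdd_belowI)
    then show False using p q assms(2) by auto
  next
    case False
    then have ub: "\<And>z. z \<in> I \<Longrightarrow> z \<le> q" using conv p q by (meson linear not_less)
    then have "Sup I \<le> q" "p \<le> Sup I"
      using p by (auto intro!: cSup_least cSup_upper bdd_aboveI)
    then show False using p q assms(2) by auto
  qed
qed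

text \<open>The second derivative is the constant \<open>2 * a\<close>, so \<open>a \<ge> 0\<close>
  gives convexity, and sublevel sets of convex functions on the line are intervals. It serves both
  the envelope bound and the times when a pair is within distance \<open>eps\<close>.\<close>

lemma convex_quadratic_sublevel:
  fixes a b c :: real
  assumes "a \<ge> 0"
  shows "is_interval {t. a * t\<^sup>2 + b * t + c \<le> 0}"
proof -
  have "convex_on UNIV (\<lambda>t::real. a * t\<^sup>2 + b * t + c)"
    by (rule f''_ge0_imp_convex[where f' = "\<lambda>t. 2 * a * t + b" and f'' = "\<lambda>_. 2 * a"])
      (auto intro!: derivative_eq_intros simp: assms)
  then have "a * (u * x + v * y)\<^sup>2 + b * (u * x + v * y) + c
      \<le> u * (a * x\<^sup>2 + b * x + c) + v * (a * y\<^sup>2 + b * y + c)"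
    if "0 \<le> u" "0 \<le> v" "u + v = 1" for u v x y
    using that by (auto simp: convex_on_def)
  then have "convex {t. a * t\<^sup>2 + b * t + c \<le> 0}"
    unfolding convex_def
    by (auto, smt (verit) mult_nonneg_nonpos)
  then show ?thesis by (simp add: is_interval_convex_1)
qed

text \<open>Inserting the functions by increasing leading coefficient, the set where the new function is
  minimal is an interval, so each insertion costs at most two breakpoints.\<close>

lemma lower_envelope_quadratic:
  fixes q :: "'i \<Rightarrow> real \<Rightarrow> real"
  assumes "finite S" "S \<noteq> {}" "\<And>i. i \<in> S \<Longrightarrow> quadratic_on J (q i)"
  obtains B where "finite B" "card B \<le> 2 * card S"
    "\<And>x y. \<lbrakk>x < y; {x<..<y} \<subseteq> J; {x<..<y} \<inter> B = {}\<rbrakk> \<Longrightarrow>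
       \<exists>i\<in>S. \<forall>t\<in>{x<..<y}. \<forall>k\<in>S. q i t \<le> q k t"
proof -
  obtain a b c where abc: "\<And>i t. i \<in> S \<Longrightarrow> t \<in> J \<Longrightarrow> q i t = a i * t\<^sup>2 + b i * t + c i"
    using assms(3) unfolding quadratic_on_def by metis
  \<comment> \<open>The polynomials are extended to the whole line, so that the induction need not
    mention \<open>J\<close>.\<close>
  define p where "p i t = a i * t\<^sup>2 + b i * t + c i" for i t
  have "S \<noteq> {} \<longrightarrow> (\<exists>B. finite B \<and> card B \<le> 2 * card S \<and>
    (\<forall>x y. x < y \<longrightarrow> {x<..<y} \<inter> B = {} \<longrightarrow> (\<exists>i\<in>S. \<forall>t\<in>{x<..<y}. \<forall>k\<in>S. p i t \<le> p k t)))"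
    using assms(1)
  proof (induction S rule: finite_ranking_induct[where f = a])
    case empty then show ?case by simp
  next
    case (insert x S)
    show ?case
    \<comment> \<open>\<open>finite_ranking_induct\<close> lets the inserted element already lie in
      \<open>S\<close>; then nothing changes. A first element needs no breakpoint.\<close>
    proof (cases "S = {} \<or> x \<in> S")
      case True
      then show ?thesis
        using insert.IH by (cases "S = {}") (auto simp: insert_absorb intro!: exI[of _ "{}"])
    next
      case False
      then obtain B where B: "finite B" "card B \<le> 2 * card S"
        "\<And>u v. u < v \<Longrightarrow> {u<..<v} \<inter> B = {} \<Longrightarrow> \<exists>i\<in>S. \<forall>t\<in>{u<..<v}. \<forall>k\<in>S. p i t \<le> p k t"
        using insert.IH by blast
      define I where "I = (\<Inter>k\<in>S. {t. p x t \<le> p k t})"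
      have "is_interval {t. p x t \<le> p k t}" if "k \<in> S" for k
      proof -
        have "{t. p x t \<le> p k t} = {t. (a x - a k) * t\<^sup>2 + (b x - b k) * t + (c x - c k) \<le> 0}"
          by (auto simp: p_def algebra_simps)
        then show ?thesis using convex_quadratic_sublevel[of "a x - a k"] insert.hyps(2)[OF that] by simp
      qed
      then have I: "is_interval I" unfolding I_def is_interval_1 by blast
      have "card (B \<union> {Inf I, Sup I}) \<le> card B + card {Inf I, Sup I}" by (rule card_Un_le)
      also have "\<dots> \<le> 2 * card S + 2"
        using B(2) by (auto intro!: add_mono simp: card_insert_if)
      also have "\<dots> = 2 * card (insert x S)" using False insert.hyps(1) by simp
      finally have crd: "card (B \<union> {Inf I, Sup I}) \<le> 2 * card (insert x S)" .
      have "\<exists>i\<in>insert x S. \<forall>t\<in>{u<..<v}. \<forall>k\<in>insert x S. p i t \<le> p k t"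
        if uv: "u < v" "{u<..<v} \<inter> (B \<union> {Inf I, Sup I}) = {}" for u v
      proof -
        obtain i where i: "i \<in> S" "\<forall>t\<in>{u<..<v}. \<forall>k\<in>S. p i t \<le> p k t"
          using B(3)[of u v] uv by blast
        have "{u<..<v} \<inter> {Inf I, Sup I} = {}" using uv by blast
        from is_interval_exceptional[OF I this] show ?thesis
        proof
          assume "{u<..<v} \<subseteq> I"
          then show ?thesis by (intro bexI[of _ x]) (auto simp: I_def)
        next
          \<comment> \<open>Off \<open>I\<close> some old function lies strictly below
            \<open>p x\<close>, and the old minimiser \<open>i\<close> lies below that one, so
            \<open>i\<close> remains minimal.\<close>
          assume disj: "{u<..<v} \<inter> I = {}"
          have "p i t \<le> p x t" if t: "t \<in> {u<..<v}" for t
          proof -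
            obtain k where "k \<in> S" "\<not> p x t \<le> p k t" using disj t unfolding I_def by blast
            then show ?thesis using i t by force
          qed
          then show ?thesis using i by (intro bexI[of _ i]) auto
        qed
      qed
      then show ?thesis
        using crd B(1) by (intro impI exI[of _ "B \<union> {Inf I, Sup I}"]) auto
    qed
  qed
  then obtain B where B: "finite B" "card B \<le> 2 * card S"
    "\<And>x y. x < y \<Longrightarrow> {x<..<y} \<inter> B = {} \<Longrightarrow> \<exists>i\<in>S. \<forall>t\<in>{x<..<y}. \<forall>k\<in>S. p i t \<le> p k t"
    using assms(2) by auto
  show thesis
  proof (rule that[OF B(1,2)])
    fix x y assume xy: "x < y" "{x<..<y} \<subseteq> J" "{x<..<y} \<inter> B = {}"
    then obtain i where "i \<in> S" "\<forall>t\<in>{x<..<y}. \<forall>k\<in>S. p i t \<le> p k t" using B(3) by blast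
    then show "\<exists>i\<in>S. \<forall>t\<in>{x<..<y}. \<forall>k\<in>S. q i t \<le> q k t"
      using abc xy(2) by (intro bexI[of _ i]) (auto simp: p_def subset_iff)
  qed
qed

text \<open>Quantifying over all subintervals free of \<open>B\<close>, rather than over the gaps of
  \<open>B\<close>, makes the notion survive enlarging \<open>B\<close>, so functions with different
  breakpoints can be combined.\<close>

definition piecewise_quadratic :: "real \<Rightarrow> real \<Rightarrow> real set \<Rightarrow> (real \<Rightarrow> real) \<Rightarrow> bool" where
  "piecewise_quadratic a b B f \<longleftrightarrow>
     (\<forall>x y. a \<le> x \<longrightarrow> x < y \<longrightarrow> y \<le> b \<longrightarrow> {x<..<y} \<inter> B = {} \<longrightarrow> quadratic_on {x<..<y} f)"

text \<open>Only a strict reversal of order is ruled out, so a finite \<open>Z\<close> can suffice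
  even when the zeros of \<open>f - g\<close> fill an interval.\<close>

definition separates_crossings ::
  "real \<Rightarrow> real \<Rightarrow> real set \<Rightarrow> (real \<Rightarrow> real) \<Rightarrow> (real \<Rightarrow> real) \<Rightarrow> bool" where
  "separates_crossings a b Z f g \<longleftrightarrow>
     (\<forall>x y s t. a \<le> x \<longrightarrow> x < y \<longrightarrow> y \<le> b \<longrightarrow> {x<..<y} \<inter> Z = {} \<longrightarrow> s \<in> {x<..<y} \<longrightarrow> t \<in> {x<..<y} \<longrightarrow>
        f s < g s \<longrightarrow> f t \<le> g t)"

text \<open>On each gap the lower envelope of the two functions \<open>f\<close> and 0 has at most
  four breakpoints, and between them one of the two is minimal throughout, so \<open>f\<close> keeps
  a weak sign. Adding \<open>B\<close> itself gives \<open>4 * card B + card B\<close>.\<close>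

lemma piecewise_quadratic_sign_changes:
  assumes "finite B" "a \<in> B" "b \<in> B" and f: "piecewise_quadratic a b B f" and sub: "B \<subseteq> {a..b}"
  obtains Z where "finite Z" "card Z \<le> 5 * card B"
    "separates_crossings a b Z f (\<lambda>_. 0)"
proof -
  have "\<exists>Z. finite Z \<and> card Z \<le> 4 \<and> (\<forall>x y. x < y \<longrightarrow> {x<..<y} \<subseteq> {fst g<..<snd g} \<longrightarrow>
      {x<..<y} \<inter> Z = {} \<longrightarrow> (\<forall>t\<in>{x<..<y}. f t \<le> 0) \<or> (\<forall>t\<in>{x<..<y}. 0 \<le> f t))"
    if g: "g \<in> gaps B" for g
  proof -
    define q where "q i = (if i then f else (\<lambda>_. 0))" for i :: bool
    have gg: "fst g \<in> B" "snd g \<in> B" "fst g < snd g" "B \<inter> {fst g<..<snd g} = {}"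
      using gapsD[of "fst g" "snd g" B] g by auto
    have "quadratic_on {fst g<..<snd g} f"
      using f gg sub unfolding piecewise_quadratic_def
      by (metis Int_commute atLeastAtMost_iff subsetD)
    moreover have "quadratic_on {fst g<..<snd g} (\<lambda>_. 0)"
      by (rule quadratic_on_zero)
    ultimately have "\<And>i. i \<in> UNIV \<Longrightarrow> quadratic_on {fst g<..<snd g} (q i)"
      by (auto simp: q_def)
    then obtain Z where "finite Z" "card Z \<le> 2 * card (UNIV :: bool set)"
      "\<And>x y. \<lbrakk>x < y; {x<..<y} \<subseteq> {fst g<..<snd g}; {x<..<y} \<inter> Z = {}\<rbrakk> \<Longrightarrow>
         \<exists>i\<in>UNIV. \<forall>t\<in>{x<..<y}. \<forall>k\<in>UNIV. q i t \<le> q k t"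
      using lower_envelope_quadratic[of "UNIV :: bool set" "{fst g<..<snd g}" q] by auto
    then show ?thesis
      by (intro exI[of _ Z]) (auto simp: q_def UNIV_bool)
  qed
  then obtain Z where Z: "\<And>g. g \<in> gaps B \<Longrightarrow> finite (Z g) \<and> card (Z g) \<le> 4 \<and>
      (\<forall>x y. x < y \<longrightarrow> {x<..<y} \<subseteq> {fst g<..<snd g} \<longrightarrow>
      {x<..<y} \<inter> Z g = {} \<longrightarrow> (\<forall>t\<in>{x<..<y}. f t \<le> 0) \<or> (\<forall>t\<in>{x<..<y}. 0 \<le> f t))"
    by metis
  show thesis
  proof (rule that[of "B \<union> (\<Union>g\<in>gaps B. Z g)"])
    show "finite (B \<union> (\<Union>g\<in>gaps B. Z g))" using Z assms(1) finite_gaps by auto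
    have "card (\<Union>g\<in>gaps B. Z g) \<le> (\<Sum>g\<in>gaps B. card (Z g))"
      by (rule card_UN_le) (use assms finite_gaps in auto)
    also have "\<dots> \<le> card (gaps B) * 4" using Z sum_bounded_above[of "gaps B" "\<lambda>g. card (Z g)" 4] by auto
    also have "\<dots> \<le> card B * 4" using card_gaps_le[OF assms(1)] by simp
    finally show "card (B \<union> (\<Union>g\<in>gaps B. Z g)) \<le> 5 * card B"
      using card_Un_le[of B "\<Union>g\<in>gaps B. Z g"] by linarith
    show "separates_crossings a b (B \<union> (\<Union>g\<in>gaps B. Z g)) f (\<lambda>_. 0)"
      unfolding separates_crossings_def
    proof (intro allI impI)
      fix x y s t
      assume xy: "a \<le> x" "x < y" "y \<le> b" "{x<..<y} \<inter> (B \<union> (\<Union>g\<in>gaps B. Z g)) = {}"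
        and st: "s \<in> {x<..<y}" "t \<in> {x<..<y}" "f s < 0"
      have "B \<inter> {x<..<y} = {}" using xy(4) by blast
      then obtain u v where uv: "(u, v) \<in> gaps B" "u \<le> x" "y \<le> v"
        using gap_containing[OF assms(1-3) xy(1-3)] by blast
      have "{x<..<y} \<inter> Z (u, v) = {}" using xy(4) uv(1) by blast
      then have "(\<forall>t\<in>{x<..<y}. f t \<le> 0) \<or> (\<forall>t\<in>{x<..<y}. 0 \<le> f t)"
        using Z[OF uv(1)] xy(2) uv by (simp add: greaterThanLessThan_subseteq_greaterThanLessThan)
      then show "f t \<le> 0" using st by force
    qed
  qed
qed

section \<open>Piecewise linear motion\<close>

lemma continuous_on_Max_image:
  fixes f :: "'i \<Rightarrow> 'b::topological_space \<Rightarrow> real"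
  assumes "finite A" "A \<noteq> {}" "\<And>i. i \<in> A \<Longrightarrow> continuous_on S (f i)"
  shows "continuous_on S (\<lambda>t. Max ((\<lambda>i. f i t) ` A))"
  using assms
proof (induction A rule: finite_ne_induct)
  case (singleton x)
  then show ?case by simp
next
  case (insert x F)
  have "continuous_on S (\<lambda>t. max (f x t) (Max ((\<lambda>i. f i t) ` F)))"
    using insert by (intro continuous_on_max) auto
  then show ?case using insert.hyps by simp
qed

text \<open>Redefining \<open>g\<close> to equal \<open>f\<close> on \<open>F\<close> does not
  change its integral and makes the inequality hold at every point.\<close>

lemma integral_le_off_finite:
  fixes f g :: "real \<Rightarrow> real"
  assumes "finite F" "f integrable_on S" "g integrable_on S" "\<And>t. t \<in> S - F \<Longrightarrow> f t \<le> g t"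
  shows "integral S f \<le> integral S g"
proof -
  let ?g = "\<lambda>t. if t \<in> F then f t else g t"
  have "?g integrable_on S"
    by (rule integrable_spike_finite[OF assms(1) _ assms(3)]) auto
  then have "integral S f \<le> integral S ?g"
    using assms(2,4) by (intro integral_le) auto
  also have "integral S ?g = integral S g"
    by (rule integral_spike[OF negligible_finite[OF assms(1)]]) auto
  finally show ?thesis .
qed

lemma card_UN_bound:
  assumes "finite I" "\<And>i. i \<in> I \<Longrightarrow> card (A i) \<le> k"
  shows "card (\<Union>i\<in>I. A i) \<le> card I * k"
proof -
  have "card (\<Union>i\<in>I. A i) \<le> (\<Sum>i\<in>I. card (A i))" by (rule card_UN_le[OF assms(1)])
  also have "\<dots> \<le> card I * k" using sum_bounded_above[of I "\<lambda>i. card (A i)" k] assms by simp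
  finally show ?thesis .
qed

section \<open>Connectivity and trajectoids\<close>

lemma eps_connected_refl: "eps_connected n X eps t i i"
  by (simp add: eps_connected_def)

lemma eps_connected_trans:
  "eps_connected n X eps t i j \<Longrightarrow> eps_connected n X eps t j k \<Longrightarrow> eps_connected n X eps t i k"
  unfolding eps_connected_def by (rule rtranclp_trans)

lemma eps_connected_sym:
  assumes "eps_connected n X eps t i j"
  shows "eps_connected n X eps t j i"
proof -
  have "symp (\<lambda>a b. a < n \<and> b < n \<and> dist (X a t) (X b t) \<le> eps)"
    by (auto simp: symp_def dist_commute)
  then have "symp (\<lambda>a b. a < n \<and> b < n \<and> dist (X a t) (X b t) \<le> eps)\<^sup>*\<^sup>*"
    by (rule symp_rtranclp)
  then show ?thesis using assms unfolding eps_connected_def by (auto dest: sympD)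
qed

text \<open>Each entity outside the component of \<open>T t\<close> is avoided on some neighbourhood
  of \<open>t\<close>; as there are only \<open>n\<close> entities, one neighbourhood works for
  all.\<close>

lemma trajectoid_eventually_connected:
  assumes "trajectoid n X eps a b T" "t \<in> {a..b}"
  shows "\<forall>\<^sub>F s in at t within {a..b}. eps_connected n X eps t (T t) (T s)"
proof -
  have "\<forall>\<^sub>F s in at t within {a..b}. T s \<noteq> k" if "\<not> eps_connected n X eps t (T t) k" for k
  proof -
    have "\<not> (\<forall>\<delta>>0. \<exists>s\<in>{a..b}. \<bar>s - t\<bar> < \<delta> \<and> T s = k)"
      using assms that unfolding trajectoid_def by blast
    then obtain d where "d > 0" "\<And>s. s \<in> {a..b} \<Longrightarrow> \<bar>s - t\<bar> < d \<Longrightarrow> T s \<noteq> k" by blast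
    then show ?thesis unfolding eventually_at dist_real_def by blast
  qed
  then have "\<forall>\<^sub>F s in at t within {a..b}. \<forall>k\<in>{k. k < n \<and> \<not> eps_connected n X eps t (T t) k}. T s \<noteq> k"
    by (intro eventually_ball_finite) auto
  moreover have "\<forall>\<^sub>F s in at t within {a..b}. s \<in> {a..b}"
    unfolding eventually_at by (auto intro: exI[of _ 1])
  ultimately show ?thesis
    by eventually_elim (use assms(1) in \<open>auto simp: trajectoid_def\<close>)
qed

section \<open>Breakpoints and events of the motion\<close>

locale linear_motion =
  fixes n tau :: nat and tm :: "nat \<Rightarrow> real" and X :: "nat \<Rightarrow> real \<Rightarrow> 'a::euclidean_space"
    and eps :: real
  assumes n_pos: "n \<ge> 1" and tau_pos: "tau \<ge> 1" and eps_pos: "eps > 0"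
    and strict_mono_tm: "strict_mono_on {0..tau} tm"
    and piecewise_linear: "piecewise_linear_trajs n tau tm X"
begin

abbreviation "t0 \<equiv> tm 0"
abbreviation "t1 \<equiv> tm tau"
abbreviation "vertices \<equiv> tm ` {..tau}"
abbreviation "D \<equiv> Dmax n X"
abbreviation "conn \<equiv> eps_connected n X eps"

lemma tm_less: "i < j \<Longrightarrow> j \<le> tau \<Longrightarrow> tm i < tm j"
  using strict_mono_tm by (auto simp: strict_mono_on_def)

lemma tm_le: "i \<le> j \<Longrightarrow> j \<le> tau \<Longrightarrow> tm i \<le> tm j"
  using tm_less[of i j] by (cases "i = j") auto

lemma t0_less_t1: "t0 < t1"
  using tm_less tau_pos by simp

lemma vertices_subset: "vertices \<subseteq> {t0..t1}"
  using tm_le by auto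

lemma card_vertices_le: "card vertices \<le> tau + 1"
  using card_image_le[of "{..tau}" tm] by simp

lemma interval_in_piece:
  assumes "t0 \<le> x" "x < y" "y \<le> t1" "{x<..<y} \<inter> vertices = {}"
  obtains j where "j < tau" "tm j \<le> x" "y \<le> tm (Suc j)"
proof -
  \<comment> \<open>\<open>j\<close> is the first vertex beyond \<open>x\<close>; it is not 0
    because \<open>t0 \<le> x\<close>, so the piece sought is the one ending at
    \<open>tm j\<close>.\<close>
  define j where "j = (LEAST j. x < tm j)"
  have "x < tm tau" using assms by simp
  then have j: "x < tm j" "j \<le> tau"
    unfolding j_def by (rule LeastI, rule Least_le)
  have "j \<noteq> 0" using j(1) assms(1) by (cases j) auto
  then obtain i where i: "j = Suc i" by (cases j) auto
  have "\<not> x < tm i" using not_less_Least[of i "\<lambda>j. x < tm j"] i by (simp add: j_def)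
  moreover have "y \<le> tm (Suc i)" using assms(4) j i by (force simp: disjoint_iff)
  ultimately show thesis using that[of i] j i by simp
qed

text \<open>The relative motion is affine in time, so its squared norm is quadratic with the squared
  relative speed as leading coefficient. The sign of that coefficient is recorded for the convexity
  argument on distance \<open>eps\<close>.\<close>

lemma dist_sq_quadratic:
  assumes "j < tau" "i < n" "k < n"
  obtains a b c where "a \<ge> 0"
    "\<And>t. t \<in> {tm j..tm (Suc j)} \<Longrightarrow> (dist (X i t) (X k t))\<^sup>2 = a * t\<^sup>2 + b * t + c"
proof -
  obtain A V A' V' where
    AV: "\<forall>t\<in>{tm j..tm (Suc j)}. X i t = A + t *\<^sub>R V" "\<forall>t\<in>{tm j..tm (Suc j)}. X k t = A' + t *\<^sub>R V'"
    using piecewise_linear assms unfolding piecewise_linear_trajs_def by metis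
  define u w where "u = A - A'" and "w = V - V'"
  show thesis
  proof (rule that[of "w \<bullet> w" "2 * (u \<bullet> w)" "u \<bullet> u"])
    fix t assume "t \<in> {tm j..tm (Suc j)}"
    then have "X i t - X k t = u + t *\<^sub>R w"
      using AV by (simp add: u_def w_def algebra_simps)
    then show "(dist (X i t) (X k t))\<^sup>2 = w \<bullet> w * t\<^sup>2 + 2 * (u \<bullet> w) * t + u \<bullet> u"
      unfolding dist_norm power2_norm_eq_inner
      by (simp add: inner_commute algebra_simps power2_eq_square)
  qed simp
qed

text \<open>The linear formulas hold on closed pieces, so consecutive pieces agree at their common
  vertex and can be glued.\<close>

lemma continuous_on_X:
  assumes "i < n"
  shows "continuous_on {t0..t1} (X i)"
proof -
  have "continuous_on {tm 0..tm j} (X i)" if "j \<le> tau" for j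
    using that
  proof (induction j)
    case 0
    then show ?case by simp
  next
    case (Suc j)
    obtain a b where "\<forall>t\<in>{tm j..tm (Suc j)}. X i t = a + t *\<^sub>R b"
      using piecewise_linear Suc.prems assms unfolding piecewise_linear_trajs_def by (meson Suc_le_lessD)
    moreover have "continuous_on {tm j..tm (Suc j)} (\<lambda>t. a + t *\<^sub>R b)"
      by (intro continuous_intros)
    ultimately have "continuous_on {tm j..tm (Suc j)} (X i)"
      using continuous_on_cong[OF refl] by (metis (no_types, lifting))
    then have "continuous_on ({tm 0..tm j} \<union> {tm j..tm (Suc j)}) (X i)"
      using Suc by (intro continuous_on_closed_Un) auto
    then show ?case
      using tm_le[of 0 j] tm_le[of j "Suc j"] Suc.prems by (simp add: ivl_disj_un_two_touch)
  qed
  then show ?thesis by simp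
qed

lemma dist_le_D: "k < n \<Longrightarrow> dist (X i t) (X k t) \<le> D i t"
  unfolding Dmax_def by (intro Max_ge) auto

lemma D_nonneg: "0 \<le> D i t"
  using order_trans[OF zero_le_dist dist_le_D[of 0]] n_pos by simp

lemma D_le: "(\<And>k. k < n \<Longrightarrow> dist (X i t) (X k t) \<le> r) \<Longrightarrow> D i t \<le> r"
  unfolding Dmax_def using n_pos by (intro Max.boundedI) (auto simp: lessThan_empty_iff)

lemma D_sq_le_iff: "(D i t)\<^sup>2 \<le> (D k t)\<^sup>2 \<longleftrightarrow> D i t \<le> D k t"
  using D_nonneg by (simp add: abs_le_square_iff[symmetric])

lemma continuous_on_D:
  assumes "i < n"
  shows "continuous_on {t0..t1} (D i)"
  unfolding Dmax_def
  using assms n_pos continuous_on_X by (intro continuous_on_Max_image continuous_on_dist) auto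

text \<open>Negating the squared distances turns the farthest entity into a minimiser, so the lower
  envelope bound \<open>2 * n\<close> applies on each of the \<open>tau\<close> linear pieces.
  Between breakpoints one entity \<open>l\<close> stays farthest from \<open>i\<close>, and
  \<open>D i\<close> is the distance to it.\<close>

lemma D_sq_breakpoints:
  assumes "i < n"
  obtains B where "finite B" "B \<subseteq> {t0..t1}" "card B \<le> 2 * n * tau"
    "piecewise_quadratic t0 t1 (vertices \<union> B) (\<lambda>t. (D i t)\<^sup>2)"
proof -
  let ?J = "\<lambda>j. {tm j..tm (Suc j)}"
  define q where "q k t = - (dist (X i t) (X k t))\<^sup>2" for k t
  have q: "quadratic_on (?J j) (\<lambda>t. (dist (X i t) (X k t))\<^sup>2)" if "j < tau" "k < n" for j k
    using dist_sq_quadratic[OF that(1) assms that(2)] unfolding quadratic_on_def by metis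
  have "\<exists>B. finite B \<and> card B \<le> 2 * n \<and> (\<forall>x y. x < y \<longrightarrow> {x<..<y} \<subseteq> ?J j \<longrightarrow> {x<..<y} \<inter> B = {} \<longrightarrow>
      (\<exists>l<n. \<forall>t\<in>{x<..<y}. \<forall>k<n. q l t \<le> q k t))" if "j < tau" for j
  proof -
    have ne: "{..<n} \<noteq> {}" "finite {..<n}" using n_pos by (auto simp: lessThan_empty_iff)
    have "\<And>k. k \<in> {..<n} \<Longrightarrow> quadratic_on (?J j) (q k)"
      unfolding q_def using q that by (intro quadratic_on_uminus) auto
    then obtain B where "finite B" "card B \<le> 2 * card {..<n}"
      "\<And>x y. \<lbrakk>x < y; {x<..<y} \<subseteq> ?J j; {x<..<y} \<inter> B = {}\<rbrakk> \<Longrightarrow>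
         \<exists>l\<in>{..<n}. \<forall>t\<in>{x<..<y}. \<forall>k\<in>{..<n}. q l t \<le> q k t"
      using lower_envelope_quadratic[of "{..<n}" "?J j" q] ne by blast
    then show ?thesis unfolding Ball_def Bex_def lessThan_iff by (intro exI[of _ B]) auto
  qed
  then obtain B where B: "\<And>j. j < tau \<Longrightarrow> finite (B j)" "\<And>j. j < tau \<Longrightarrow> card (B j) \<le> 2 * n"
    "\<And>j x y. \<lbrakk>j < tau; x < y; {x<..<y} \<subseteq> ?J j; {x<..<y} \<inter> B j = {}\<rbrakk> \<Longrightarrow>
       \<exists>l<n. \<forall>t\<in>{x<..<y}. \<forall>k<n. q l t \<le> q k t"
    by metis
  define B' where "B' = (\<Union>j<tau. B j)"
  show thesis
  proof (rule that[of "B' \<inter> {t0..t1}"])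
    have fin: "finite B'" using B(1) by (auto simp: B'_def)
    then show "finite (B' \<inter> {t0..t1})" by simp
    have "card (B' \<inter> {t0..t1}) \<le> card B'" using fin by (intro card_mono) auto
    also have "\<dots> \<le> tau * (2 * n)"
      unfolding B'_def using card_UN_bound[of "{..<tau}" B "2 * n"] B(2) by simp
    finally show "card (B' \<inter> {t0..t1}) \<le> 2 * n * tau" by (simp add: ac_simps)
    show "piecewise_quadratic t0 t1 (vertices \<union> (B' \<inter> {t0..t1})) (\<lambda>t. (D i t)\<^sup>2)"
      unfolding piecewise_quadratic_def
    proof (intro allI impI)
      fix x y
      assume "t0 \<le> x" "x < y" "y \<le> t1" "{x<..<y} \<inter> (vertices \<union> (B' \<inter> {t0..t1})) = {}"
      then have xy: "t0 \<le> x" "x < y" "y \<le> t1" "{x<..<y} \<inter> vertices = {}" "{x<..<y} \<inter> (B' \<inter> {t0..t1}) = {}"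
        by blast+
      obtain j where j: "j < tau" "tm j \<le> x" "y \<le> tm (Suc j)" using interval_in_piece[OF xy(1-4)] .
      have sub: "{x<..<y} \<subseteq> ?J j" using j by auto
      have "{x<..<y} \<subseteq> {t0..t1}" using xy by auto
      then have "{x<..<y} \<inter> B j = {}" using xy(5) j(1) unfolding B'_def by blast
      then obtain l where l: "l < n" "\<forall>t\<in>{x<..<y}. \<forall>k<n. q l t \<le> q k t"
        using B(3)[OF j(1) xy(2) sub] by blast
      have "D i t = dist (X i t) (X l t)" if "t \<in> {x<..<y}" for t
      proof (rule antisym)
        show "D i t \<le> dist (X i t) (X l t)"
          using l that by (intro D_le) (auto simp: q_def intro: power2_le_imp_le)
      qed (rule dist_le_D[OF l(1)])
      moreover have "quadratic_on {x<..<y} (\<lambda>t. (dist (X i t) (X l t))\<^sup>2)"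
        using q[OF j(1) l(1)] sub quadratic_on_subset by blast
      ultimately show "quadratic_on {x<..<y} (\<lambda>t. (D i t)\<^sup>2)"
        unfolding quadratic_on_def by (metis (no_types, lifting))
    qed
  qed auto
qed

text \<open>On a linear piece the times at which a pair is within \<open>eps\<close> form an
  interval by convexity, so its two ends are the only places where the status can change. Ordered
  pairs over all pieces give \<open>2 * n * n * tau\<close>.\<close>

lemma eps_events:
  obtains B where "finite B" "B \<subseteq> {t0..t1}" "card B \<le> 2 * n * n * tau"
    "\<And>x y i k s t. \<lbrakk>t0 \<le> x; x < y; y \<le> t1; {x<..<y} \<inter> vertices = {}; {x<..<y} \<inter> B = {};
       i < n; k < n; s \<in> {x<..<y}; t \<in> {x<..<y}; dist (X i s) (X k s) \<le> eps\<rbrakk> \<Longrightarrow>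
       dist (X i t) (X k t) \<le> eps"
proof -
  have "\<exists>I. is_interval I \<and> (\<forall>t\<in>{tm j..tm (Suc j)}. dist (X i t) (X k t) \<le> eps \<longleftrightarrow> t \<in> I)"
    if jik: "j < tau" "i < n" "k < n" for i j k
  proof -
    obtain a b c where abc: "a \<ge> 0"
      "\<And>t. t \<in> {tm j..tm (Suc j)} \<Longrightarrow> (dist (X i t) (X k t))\<^sup>2 = a * t\<^sup>2 + b * t + c"
      using dist_sq_quadratic[OF jik] by blast
    have "dist (X i t) (X k t) \<le> eps \<longleftrightarrow> (dist (X i t) (X k t))\<^sup>2 \<le> eps\<^sup>2" for t
      using eps_pos by (metis less_imp_le power2_le_imp_le power_mono zero_le_dist)
    then show ?thesis
      using convex_quadratic_sublevel[OF abc(1), of b "c - eps\<^sup>2"] abc(2)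
      by (intro exI[of _ "{t. a * t\<^sup>2 + b * t + (c - eps\<^sup>2) \<le> 0}"]) (auto simp: algebra_simps)
  qed
  then obtain I where I: "\<And>j i k. \<lbrakk>j < tau; i < n; k < n\<rbrakk> \<Longrightarrow> is_interval (I j i k)"
    "\<And>j i k t. \<lbrakk>j < tau; i < n; k < n; t \<in> {tm j..tm (Suc j)}\<rbrakk> \<Longrightarrow>
       dist (X i t) (X k t) \<le> eps \<longleftrightarrow> t \<in> I j i k"
    by metis
  define P where "P = {..<tau} \<times> {..<n} \<times> {..<n}"
  define E where "E = (\<lambda>(j, i, k). {Inf (I j i k), Sup (I j i k)})"
  define B where "B = (\<Union>p\<in>P. E p)"
  show thesis
  proof (rule that[of "B \<inter> {t0..t1}"])
    have finP: "finite P" and cardP: "card P = tau * (n * n)" by (auto simp: P_def card_cartesian_product)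
    have cardE: "card (E p) \<le> 2" for p by (auto simp: E_def card_insert_if split: prod.split)
    have fin: "finite B" using finP by (auto simp: B_def E_def)
    then show "finite (B \<inter> {t0..t1})" by simp
    have "card (B \<inter> {t0..t1}) \<le> card B" using fin by (intro card_mono) auto
    also have "\<dots> \<le> card P * 2" unfolding B_def using finP cardE by (intro card_UN_bound)
    finally show "card (B \<inter> {t0..t1}) \<le> 2 * n * n * tau" by (simp add: cardP ac_simps)
    fix x y i k s t
    assume xy: "t0 \<le> x" "x < y" "y \<le> t1" "{x<..<y} \<inter> vertices = {}" "{x<..<y} \<inter> (B \<inter> {t0..t1}) = {}"
      and ik: "i < n" "k < n" and st: "s \<in> {x<..<y}" "t \<in> {x<..<y}" "dist (X i s) (X k s) \<le> eps"
    obtain j where j: "j < tau" "tm j \<le> x" "y \<le> tm (Suc j)" using interval_in_piece[OF xy(1-4)] .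
    have sub: "{x<..<y} \<subseteq> {tm j..tm (Suc j)}" using j by auto
    have "{x<..<y} \<subseteq> {t0..t1}" using xy by auto
    moreover have "{Inf (I j i k), Sup (I j i k)} \<subseteq> B"
      using j ik by (force simp: B_def E_def P_def)
    ultimately have "{x<..<y} \<inter> {Inf (I j i k), Sup (I j i k)} = {}" using xy(5) by blast
    then have "{x<..<y} \<subseteq> I j i k \<or> {x<..<y} \<inter> I j i k = {}"
      by (rule is_interval_exceptional[OF I(1)[OF j(1) ik]])
    then show "dist (X i t) (X k t) \<le> eps"
      using st sub I(2)[OF j(1) ik] by blast
  qed auto
qed

text \<open>\<open>B\<close> collects the vertices, the \<open>eps\<close> events and the
  breakpoints of all \<open>D i\<close>, at most
  \<open>(tau + 1) + 2 * n\<^sup>2 * tau + 2 * n\<^sup>2 * tau\<close> points.\<close>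

lemma windows_exist:
  obtains B Z where "finite B" "vertices \<subseteq> B" "B \<subseteq> {t0..t1}" "card B \<le> 6 * tau * n\<^sup>2"
    "\<And>u v i. (u, v) \<in> gaps B \<Longrightarrow> i < n \<Longrightarrow> quadratic_on {u<..<v} (\<lambda>t. (D i t)\<^sup>2)"
    "\<And>u v i k s t. \<lbrakk>(u, v) \<in> gaps B; i < n; k < n; s \<in> {u<..<v}; t \<in> {u<..<v};
       dist (X i s) (X k s) \<le> eps\<rbrakk> \<Longrightarrow> dist (X i t) (X k t) \<le> eps"
    "\<And>i k. i < n \<Longrightarrow> k < n \<Longrightarrow> finite (Z i k) \<and> card (Z i k) \<le> 30 * n * tau"
    "\<And>i k. i < n \<Longrightarrow> k < n \<Longrightarrow> separates_crossings t0 t1 (Z i k) (D i) (D k)"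
proof -
  have "\<exists>B. finite B \<and> B \<subseteq> {t0..t1} \<and> card B \<le> 2 * n * tau \<and>
      piecewise_quadratic t0 t1 (vertices \<union> B) (\<lambda>t. (D i t)\<^sup>2)" if "i < n" for i
    by (rule D_sq_breakpoints[OF that]) blast
  then obtain Q where Q: "\<And>i. i < n \<Longrightarrow> finite (Q i)" "\<And>i. i < n \<Longrightarrow> Q i \<subseteq> {t0..t1}"
      "\<And>i. i < n \<Longrightarrow> card (Q i) \<le> 2 * n * tau"
      "\<And>i. i < n \<Longrightarrow> piecewise_quadratic t0 t1 (vertices \<union> Q i) (\<lambda>t. (D i t)\<^sup>2)"
    by metis
  obtain E where E: "finite E" "E \<subseteq> {t0..t1}" "card E \<le> 2 * n * n * tau"
    "\<And>x y i k s t. \<lbrakk>t0 \<le> x; x < y; y \<le> t1; {x<..<y} \<inter> vertices = {}; {x<..<y} \<inter> E = {};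
       i < n; k < n; s \<in> {x<..<y}; t \<in> {x<..<y}; dist (X i s) (X k s) \<le> eps\<rbrakk> \<Longrightarrow>
       dist (X i t) (X k t) \<le> eps"
    by (rule eps_events) blast
  define B where "B = vertices \<union> E \<union> (\<Union>i<n. Q i)"
  have "\<exists>Z. finite Z \<and> card Z \<le> 30 * n * tau \<and> separates_crossings t0 t1 Z (D i) (D k)"
    if ik: "i < n" "k < n" for i k
  proof -
    \<comment> \<open>Only the breakpoints of this pair enter, not all of \<open>B\<close>. Hence
      \<open>Z\<close> has order \<open>n * tau\<close> rather than \<open>n\<^sup>2 * tau\<close>
      points, on which the final exponent depends.\<close>
    let ?B = "vertices \<union> Q i \<union> Q k"
    have "piecewise_quadratic t0 t1 ?B (\<lambda>t. (D i t)\<^sup>2 - (D k t)\<^sup>2)"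
      unfolding piecewise_quadratic_def
    proof (intro allI impI quadratic_on_diff)
      fix x y assume "t0 \<le> x" "x < y" "y \<le> t1" "{x<..<y} \<inter> ?B = {}"
      moreover from this have "{x<..<y} \<inter> (vertices \<union> Q i) = {}" "{x<..<y} \<inter> (vertices \<union> Q k) = {}"
        by blast+
      ultimately show "quadratic_on {x<..<y} (\<lambda>t. (D i t)\<^sup>2)" "quadratic_on {x<..<y} (\<lambda>t. (D k t)\<^sup>2)"
        using Q(4)[OF ik(1)] Q(4)[OF ik(2)] unfolding piecewise_quadratic_def by blast+
    qed
    moreover have "finite ?B" "t0 \<in> ?B" "t1 \<in> ?B" "?B \<subseteq> {t0..t1}"
      using Q(1,2) ik vertices_subset by auto
    ultimately obtain Z where Z: "finite Z" "card Z \<le> 5 * card ?B"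
      "separates_crossings t0 t1 Z (\<lambda>t. (D i t)\<^sup>2 - (D k t)\<^sup>2) (\<lambda>_. 0)"
      using piecewise_quadratic_sign_changes[of ?B t0 t1 "\<lambda>t. (D i t)\<^sup>2 - (D k t)\<^sup>2"] by blast
    have "card ?B \<le> card vertices + card (Q i) + card (Q k)"
      using card_Un_le[of vertices "Q i"] card_Un_le[of "vertices \<union> Q i" "Q k"] by linarith
    also have "\<dots> \<le> (tau + 1) + 2 * n * tau + 2 * n * tau"
      using card_vertices_le Q(3) ik by (intro add_mono) auto
    also have "\<dots> \<le> 6 * n * tau"
    proof -
      have "tau \<le> n * tau" "1 \<le> n * tau" using n_pos tau_pos by auto
      then show ?thesis by (simp only: mult.assoc)
    qed
    finally have "card Z \<le> 30 * n * tau" using Z(2) by simp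
    moreover have "separates_crossings t0 t1 Z (D i) (D k)"
      using Z(3) D_sq_le_iff unfolding separates_crossings_def
      by (simp add: not_le[symmetric])
    ultimately show ?thesis using Z(1) by blast
  qed
  then obtain Z where Z: "\<And>i k. i < n \<Longrightarrow> k < n \<Longrightarrow> finite (Z i k) \<and> card (Z i k) \<le> 30 * n * tau"
    "\<And>i k. i < n \<Longrightarrow> k < n \<Longrightarrow> separates_crossings t0 t1 (Z i k) (D i) (D k)"
    by metis
  show thesis
  proof (rule that[of B Z])
    show "finite B" using E(1) Q(1) by (auto simp: B_def)
    show "vertices \<subseteq> B" by (auto simp: B_def)
    show subB: "B \<subseteq> {t0..t1}" using E(2) Q(2) vertices_subset by (auto simp: B_def)
    have "card B \<le> card vertices + card E + card (\<Union>i<n. Q i)"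
      unfolding B_def using card_Un_le[of vertices E] card_Un_le[of "vertices \<union> E" "\<Union>i<n. Q i"] by linarith
    also have "\<dots> \<le> (tau + 1) + 2 * n * n * tau + n * (2 * n * tau)"
      using card_vertices_le E(3) card_UN_bound[of "{..<n}" Q "2 * n * tau"] Q(3) by (intro add_mono) auto
    also have "\<dots> \<le> 6 * tau * n\<^sup>2"
    proof -
      have "tau \<le> n * n * tau" "1 \<le> n * n * tau" using n_pos tau_pos by auto
      moreover have "2 * n * n * tau = 2 * (n * n * tau)" "n * (2 * n * tau) = 2 * (n * n * tau)"
        "6 * tau * n\<^sup>2 = 6 * (n * n * tau)"
        by (simp_all add: power2_eq_square)
      ultimately show ?thesis by linarith
    qed
    finally show "card B \<le> 6 * tau * n\<^sup>2" .
    have gap: "t0 \<le> u \<and> u < v \<and> v \<le> t1 \<and> {u<..<v} \<inter> vertices = {} \<and> {u<..<v} \<inter> E = {} \<and>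
        (\<forall>i<n. {u<..<v} \<inter> Q i = {})" if "(u, v) \<in> gaps B" for u v
    proof -
      have "B \<inter> {u<..<v} = {}" "u < v" "u \<in> B" "v \<in> B" using gapsD[OF that] by auto
      then show ?thesis using subB by (auto simp: B_def)
    qed
    show "quadratic_on {u<..<v} (\<lambda>t. (D i t)\<^sup>2)" if "(u, v) \<in> gaps B" "i < n" for u v i
    proof -
      have "{u<..<v} \<inter> (vertices \<union> Q i) = {}" using gap[OF that(1)] that(2) by blast
      then show ?thesis
        using Q(4)[OF that(2)] gap[OF that(1)] unfolding piecewise_quadratic_def by blast
    qed
    show "dist (X i t) (X k t) \<le> eps" if "(u, v) \<in> gaps B" "i < n" "k < n" "s \<in> {u<..<v}"
      "t \<in> {u<..<v}" "dist (X i s) (X k s) \<le> eps" for u v i k s t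
      using E(4)[of u v i k s t] gap[OF that(1)] that by blast
  qed (use Z in auto)
qed

end

section \<open>Trajectoids on windows of constant connectivity\<close>

locale motion_windows = linear_motion n tau tm X eps
  for n tau :: nat and tm :: "nat \<Rightarrow> real" and X :: "nat \<Rightarrow> real \<Rightarrow> 'a::euclidean_space"
    and eps :: real +
  fixes B :: "real set" and Z :: "nat \<Rightarrow> nat \<Rightarrow> real set"
  assumes finite_B: "finite B" and vertices_B: "vertices \<subseteq> B" and B_subset: "B \<subseteq> {t0..t1}"
    and card_B: "card B \<le> 6 * tau * n\<^sup>2"
    and D_quadratic: "\<And>u v i. (u, v) \<in> gaps B \<Longrightarrow> i < n \<Longrightarrow> quadratic_on {u<..<v} (\<lambda>t. (D i t)\<^sup>2)"
    and dist_le_eps: "\<And>u v i k s t. \<lbrakk>(u, v) \<in> gaps B; i < n; k < n; s \<in> {u<..<v}; t \<in> {u<..<v};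
       dist (X i s) (X k s) \<le> eps\<rbrakk> \<Longrightarrow> dist (X i t) (X k t) \<le> eps"
    and Z: "\<And>i k. i < n \<Longrightarrow> k < n \<Longrightarrow> finite (Z i k) \<and> card (Z i k) \<le> 30 * n * tau"
    and Z_separates: "\<And>i k. i < n \<Longrightarrow> k < n \<Longrightarrow> separates_crossings t0 t1 (Z i k) (D i) (D k)"
begin

section \<open>Connectivity and envelopes within a window\<close>

lemma ends_in_B: "t0 \<in> B" "t1 \<in> B"
  using vertices_B by auto

lemma gap_bounds:
  assumes "(u, v) \<in> gaps B"
  shows "t0 \<le> u" "u < v" "v \<le> t1"
  using gapsD[OF assms] B_subset by auto

lemma gap_piece_linear:
  assumes "(u, v) \<in> gaps B" "i < n"
  shows "\<exists>a b. \<forall>t\<in>{u..v}. X i t = a + t *\<^sub>R b"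
proof -
  have "{u<..<v} \<inter> vertices = {}" using gapsD(4)[OF assms(1)] vertices_B by blast
  then obtain j where j: "j < tau" "tm j \<le> u" "v \<le> tm (Suc j)"
    using interval_in_piece gap_bounds[OF assms(1)] by blast
  then obtain a b where "\<forall>t\<in>{tm j..tm (Suc j)}. X i t = a + t *\<^sub>R b"
    using piecewise_linear assms(2) unfolding piecewise_linear_trajs_def by blast
  then show ?thesis using j by (intro exI[of _ a] exI[of _ b]) auto
qed

text \<open>Inside a window no pair changes its \<open>eps\<close> status, so every link of a chain
  persists; at the ends it survives by continuity, as \<open>dist \<le> eps\<close> is a closed
  condition. New links may appear at the ends, hence a single implication.\<close>

lemma conn_extends_to_closed_gap:
  assumes g: "(u, v) \<in> gaps B" and t: "t \<in> {u<..<v}" and s: "s \<in> {u..v}" and c: "conn t i k"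
  shows "conn s i k"
proof -
  have "dist (X a s) (X b s) \<le> eps" if ab: "a < n" "b < n" "dist (X a t) (X b t) \<le> eps" for a b
  proof (rule continuous_le_on_closure[of "{u<..<v}" "\<lambda>s. dist (X a s) (X b s)"])
    have cl: "closure {u<..<v} = {u..v}" using gap_bounds[OF g] by simp
    show "continuous_on (closure {u<..<v}) (\<lambda>s. dist (X a s) (X b s))"
      unfolding cl using gap_bounds[OF g] ab
      by (intro continuous_on_dist continuous_on_subset[OF continuous_on_X]) auto
    show "s \<in> closure {u<..<v}" using s cl by simp
    show "dist (X a r) (X b r) \<le> eps" if "r \<in> {u<..<v}" for r
      using dist_le_eps[OF g ab(1,2) t that ab(3)] .
  qed
  then show ?thesis using c unfolding eps_connected_def
    by (elim rtranclp_mono[THEN predicate2D, rotated]) auto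
qed

lemma conn_const_on_gap:
  assumes "(u, v) \<in> gaps B" "t \<in> {u<..<v}" "s \<in> {u<..<v}"
  shows "conn s i k \<longleftrightarrow> conn t i k"
  using conn_extends_to_closed_gap[OF assms(1), of _ _ i k] assms(2,3)
  by (meson greaterThanLessThan_subseteq_atLeastAtMost_iff order_refl subsetD)

text \<open>A minimum-cardinality set \<open>S\<close> realising the lower envelope on the window: each of its members
  is somewhere the strict minimum, so any two of them cross in the window.\<close>

lemma gap_envelope:
  assumes g: "(u, v) \<in> gaps B" and C: "C \<subseteq> {..<n}" "C \<noteq> {}"
  obtains E d where "finite E" "card E \<le> 2 * d"
    "d * (d - 1) \<le> (\<Sum>i<n. \<Sum>k<n. card (Z i k \<inter> {u<..<v}))"
    "\<And>x y. \<lbrakk>x < y; {x<..<y} \<subseteq> {u<..<v}; {x<..<y} \<inter> E = {}\<rbrakk> \<Longrightarrow>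
       \<exists>i\<in>C. \<forall>t\<in>{x<..<y}. \<forall>k\<in>C. D i t \<le> D k t"
proof -
  define dom where "dom S \<longleftrightarrow> S \<subseteq> C \<and> (\<forall>t\<in>{u<..<v}. \<forall>k\<in>C. \<exists>i\<in>S. D i t \<le> D k t)" for S
  have "dom C" by (auto simp: dom_def)
  then obtain S where S: "dom S" and min: "\<And>R. dom R \<Longrightarrow> card S \<le> card R"
    using ex_has_least_nat[of dom C card] by blast
  have SC: "S \<subseteq> C" and Sn: "S \<subseteq> {..<n}" using S C by (auto simp: dom_def)
  have finS: "finite S" using Sn finite_subset by blast
  have mid: "(u + v) / 2 \<in> {u<..<v}" using gap_bounds[OF g] by auto
  have "S \<noteq> {}" using S C mid unfolding dom_def by blast
  moreover have "quadratic_on {u<..<v} (\<lambda>t. (D i t)\<^sup>2)" if "i \<in> S" for i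
    using D_quadratic[OF g] that Sn by auto
  ultimately obtain E where E: "finite E" "card E \<le> 2 * card S"
    "\<And>x y. \<lbrakk>x < y; {x<..<y} \<subseteq> {u<..<v}; {x<..<y} \<inter> E = {}\<rbrakk> \<Longrightarrow>
       \<exists>i\<in>S. \<forall>t\<in>{x<..<y}. \<forall>k\<in>S. (D i t)\<^sup>2 \<le> (D k t)\<^sup>2"
    using lower_envelope_quadratic[of S "{u<..<v}" "\<lambda>i t. (D i t)\<^sup>2"] finS by blast
  have strict: "\<exists>t\<in>{u<..<v}. \<forall>k\<in>S - {i}. D i t < D k t" if i: "i \<in> S" for i
  proof -
    have "card (S - {i}) < card S" using finS i by (rule card_Diff1_less)
    then have "\<not> dom (S - {i})" using min by fastforce
    \<comment> \<open>Without \<open>i\<close> nothing in \<open>S\<close> dominates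
      \<open>D k t\<close>, so all other members lie strictly above \<open>D k t\<close>, while
      \<open>D i t\<close> does not.\<close>
    then obtain t k where tk: "t \<in> {u<..<v}" "k \<in> C" "\<forall>j\<in>S - {i}. \<not> D j t \<le> D k t"
      using SC unfolding dom_def by blast
    obtain j where "j \<in> S" "D j t \<le> D k t" using S tk unfolding dom_def by blast
    then have "D i t \<le> D k t" using tk(3) by (cases "j = i") auto
    then have "\<forall>j\<in>S - {i}. D i t < D j t"
      using tk(3) by (meson not_le order_le_less_trans)
    then show ?thesis using tk(1) by blast
  qed
  have cross: "1 \<le> card (Z i k \<inter> {u<..<v})" if ik: "i \<in> S" "k \<in> S" "i \<noteq> k" for i k
  proof -
    obtain s where s: "s \<in> {u<..<v}" "D i s < D k s" using strict[OF ik(1)] ik by blast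
    obtain t where t: "t \<in> {u<..<v}" "D k t < D i t" using strict[OF ik(2)] ik by blast
    have lt: "i < n" "k < n" using ik Sn by auto
    have "{u<..<v} \<inter> Z i k \<noteq> {}"
    proof
      assume "{u<..<v} \<inter> Z i k = {}"
      then have "D i t \<le> D k t"
        using Z_separates[OF lt] gap_bounds[OF g] s t unfolding separates_crossings_def by blast
      then show False using t by simp
    qed
    moreover have "finite (Z i k \<inter> {u<..<v})" using Z[OF lt] by blast
    ultimately show ?thesis by (simp add: Suc_le_eq card_gt_0_iff Int_commute)
  qed
  show thesis
  proof (rule that[of E "card S"])
    \<comment> \<open>This counts ordered pairs of distinct members of \<open>S\<close>, each having
      a point of its \<open>Z i k\<close> in the window.\<close>
    have "card S * (card S - 1) = (\<Sum>i\<in>S. card (S - {i}))" using finS by simp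
    also have "\<dots> = (\<Sum>i\<in>S. \<Sum>k\<in>S - {i}. 1)" by simp
    also have "\<dots> \<le> (\<Sum>i\<in>S. \<Sum>k\<in>S - {i}. card (Z i k \<inter> {u<..<v}))"
      using cross by (intro sum_mono) auto
    also have "\<dots> \<le> (\<Sum>i\<in>S. \<Sum>k<n. card (Z i k \<inter> {u<..<v}))"
      using Sn by (intro sum_mono sum_mono2) auto
    also have "\<dots> \<le> (\<Sum>i<n. \<Sum>k<n. card (Z i k \<inter> {u<..<v}))"
      using Sn by (intro sum_mono2) auto
    finally show "card S * (card S - 1) \<le> (\<Sum>i<n. \<Sum>k<n. card (Z i k \<inter> {u<..<v}))" .
    fix x y assume xy: "x < y" "{x<..<y} \<subseteq> {u<..<v}" "{x<..<y} \<inter> E = {}"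
    obtain i where i: "i \<in> S" "\<forall>t\<in>{x<..<y}. \<forall>k\<in>S. D i t \<le> D k t"
      using E(3)[OF xy] unfolding D_sq_le_iff by blast
    \<comment> \<open>The breakpoints were found for \<open>S\<close> only; domination extends
      minimality to all of \<open>C\<close>.\<close>
    have "D i t \<le> D k t" if t: "t \<in> {x<..<y}" and k: "k \<in> C" for t k
    proof -
      have "t \<in> {u<..<v}" using xy(2) t by (rule subsetD)
      then obtain j where j: "j \<in> S" "D j t \<le> D k t" using S k unfolding dom_def by meson
      have "D i t \<le> D j t" using i(2) t j(1) by simp
      then show ?thesis using j(2) by (rule order_trans)
    qed
    then show "\<exists>i\<in>C. \<forall>t\<in>{x<..<y}. \<forall>k\<in>C. D i t \<le> D k t" using i SC by blast
  qed (rule E)+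
qed

text \<open>Summed over windows, each of the \<open>n\<^sup>2\<close> ordered pairs contributes at
  most \<open>30 * n * tau\<close> to the right-hand sides, since its \<open>Z i k\<close> is split
  among disjoint windows. This bound, quadratic in \<open>d\<close>, is balanced against the number
  of windows.\<close>

lemma sum_gap_sizes_le:
  fixes d :: "real \<times> real \<Rightarrow> nat"
  assumes d: "\<And>u v. (u, v) \<in> gaps B \<Longrightarrow>
    d (u, v) * (d (u, v) - 1) \<le> (\<Sum>i<n. \<Sum>k<n. card (Z i k \<inter> {u<..<v}))"
  shows "real (\<Sum>g\<in>gaps B. d g) \<le> 42 * real tau * real n powr (5/2)"
proof -
  define P where "P g = (\<Sum>i<n. \<Sum>k<n. card (Z i k \<inter> {fst g<..<snd g}))" for g
  have sumP: "(\<Sum>g\<in>gaps B. P g) \<le> n * (n * (30 * n * tau))"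
  proof -
    have "(\<Sum>g\<in>gaps B. P g) = (\<Sum>i<n. \<Sum>k<n. \<Sum>g\<in>gaps B. card (Z i k \<inter> {fst g<..<snd g}))"
      unfolding P_def by (subst sum.swap, rule sum.cong[OF refl], subst sum.swap) simp
    also have "\<dots> \<le> (\<Sum>i<n. \<Sum>k<n. 30 * n * tau)"
    proof (intro sum_mono)
      fix i k assume "i \<in> {..<n}" "k \<in> {..<n}"
      then have "finite (Z i k)" "card (Z i k) \<le> 30 * n * tau" using Z by auto
      then show "(\<Sum>g\<in>gaps B. card (Z i k \<inter> {fst g<..<snd g})) \<le> 30 * n * tau"
        using sum_card_gaps_Int_le[OF finite_B, of "Z i k"] by (simp add: case_prod_unfold)
    qed
    finally show ?thesis by simp
  qed
  \<comment> \<open>The windows will cost order \<open>tau * n\<^sup>2 * r\<close> and the crossings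
    order \<open>tau * n\<^sup>3 / r\<close>; \<open>r = sqrt n\<close> balances the two.\<close>
  define r where "r = sqrt (real n)"
  have r: "r \<ge> 1" "r * r = real n" using n_pos by (auto simp: r_def)
  \<comment> \<open>a linearised Cauchy-Schwarz inequality\<close>
  have le: "real (d g) \<le> (1 + r) + real (P g) / r" if "g \<in> gaps B" for g
  proof (cases "real (d g) \<le> 1 + r")
    case True
    then show ?thesis using r(1) by (simp add: add_increasing2)
  next
    case False
    then have d1: "d g \<ge> 1" "r \<le> real (d g - 1)" using r(1) by (auto simp: of_nat_diff)
    have "real (d g) * r \<le> real (d g) * real (d g - 1)" using d1(2) by (intro mult_left_mono) auto
    also have "\<dots> = real (d g * (d g - 1))" by simp
    also have "\<dots> \<le> real (P g)"
      using d[of "fst g" "snd g"] that by (intro of_nat_mono) (simp add: P_def)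
    finally have "real (d g) \<le> real (P g) / r" using r(1) by (simp add: field_simps)
    then show ?thesis using r(1) by simp
  qed
  have powr: "real n powr (5/2) = real n * real n * r"
  proof -
    have "real n powr (5/2) = real n powr 2 * real n powr (1/2)"
      unfolding powr_add[symmetric] by simp
    then show ?thesis using n_pos by (simp add: r_def powr_half_sqrt power2_eq_square)
  qed
  have "real (\<Sum>g\<in>gaps B. d g) \<le> (\<Sum>g\<in>gaps B. (1 + r) + real (P g) / r)"
    using le by (simp add: sum_mono)
  also have "\<dots> = real (card (gaps B)) * (1 + r) + real (\<Sum>g\<in>gaps B. P g) / r"
    by (simp add: sum.distrib sum_divide_distrib)
  \<comment> \<open>\<open>1 + r\<close> is at most \<open>2 * r\<close> as
    \<open>r \<ge> 1\<close>. The windows then give 12 and the crossings 30, together 42.\<close>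
  also have "\<dots> \<le> (6 * real tau * (real n * real n)) * (2 * r) + (30 * real tau * (real n * real n * real n)) / r"
  proof (intro add_mono mult_mono divide_right_mono)
    have "card (gaps B) \<le> 6 * tau * n\<^sup>2" using card_gaps_le[OF finite_B] card_B by linarith
    then have "real (card (gaps B)) \<le> real (6 * tau * n\<^sup>2)" by (rule of_nat_mono)
    then show "real (card (gaps B)) \<le> 6 * real tau * (real n * real n)" by (simp add: power2_eq_square)
    have "real (\<Sum>g\<in>gaps B. P g) \<le> real (n * (n * (30 * n * tau)))" using sumP by (rule of_nat_mono)
    then show "real (\<Sum>g\<in>gaps B. P g) \<le> 30 * real tau * (real n * real n * real n)"
      by (simp add: algebra_simps)
  qed (use r(1) in auto)
  also have "(30 * real tau * (real n * real n * real n)) / r = 30 * real tau * (real n * real n * r)"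
  proof -
    have "real n = r * r" using r(2) by simp
    then have "30 * real tau * (real n * real n * real n) = 30 * real tau * (real n * real n * r) * r"
      by (metis mult.assoc)
    then show ?thesis using r(1) by (metis nonzero_mult_div_cancel_right not_one_le_zero)
  qed
  finally show ?thesis unfolding powr by (simp add: algebra_simps)
qed

section \<open>Selections of components and the trajectoids that follow their envelopes\<close>

text \<open>A selection names, for each window, a representative of the component that a trajectoid
  visits there.\<close>

definition selection :: "(real \<times> real \<Rightarrow> nat) \<Rightarrow> bool" where
  "selection c \<longleftrightarrow> (\<forall>g\<in>gaps B. c g < n) \<and>
     (\<forall>u v w. (u, v) \<in> gaps B \<longrightarrow> (v, w) \<in> gaps B \<longrightarrow> conn v (c (u, v)) (c (v, w)))"

text \<open>Near each time in a window \<open>T\<close> stays within one component, and components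
  are constant there, so connectedness of the window makes the component constant. At a shared end
  \<open>v\<close>, \<open>T v\<close> is connected to nearby values on both sides, which ties the
  two representatives together.\<close>

lemma trajectoid_selection:
  assumes T: "trajectoid n X eps t0 t1 T"
  obtains c where "selection c" "c \<in> extensional (gaps B)"
    "\<And>u v t. (u, v) \<in> gaps B \<Longrightarrow> t \<in> {u<..<v} \<Longrightarrow> conn t (c (u, v)) (T t)"
proof -
  \<comment> \<open>The midpoint is an arbitrary sample. Restricting to the gaps makes
    \<open>c\<close> extensional, so that only finitely many selections have to be compared
    later.\<close>
  define c where "c = (\<lambda>g\<in>gaps B. T ((fst g + snd g) / 2))"
  have conn_c: "conn t (c (u, v)) (T t)" if g: "(u, v) \<in> gaps B" and t: "t \<in> {u<..<v}" for u v t
  proof -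
    define h where "h = (u + v) / 2"
    have h: "h \<in> {u<..<v}" using gap_bounds[OF g] by (auto simp: h_def)
    have "conn h (T h) = conn h (T t)"
    proof (rule connected_local_const[of "{u<..<v}" h t "\<lambda>s. conn h (T s)"])
      show "\<forall>a\<in>{u<..<v}. \<forall>\<^sub>F b in at a within {u<..<v}. conn h (T a) = conn h (T b)"
      proof
        fix a assume a: "a \<in> {u<..<v}"
        have sub: "{u<..<v} \<subseteq> {t0..t1}" using gap_bounds[OF g] by auto
        then have "\<forall>\<^sub>F b in at a within {t0..t1}. conn a (T a) (T b)"
          using trajectoid_eventually_connected[OF T] a by blast
        then have "\<forall>\<^sub>F b in at a within {u<..<v}. conn a (T a) (T b)"
          using at_le[OF sub] by (rule filter_leD[rotated])
        then show "\<forall>\<^sub>F b in at a within {u<..<v}. conn h (T a) = conn h (T b)"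
        proof eventually_elim
          case (elim b)
          then have "conn h (T a) (T b)" using conn_const_on_gap[OF g a h] by simp
          then show ?case by (intro ext iffI) (blast intro: eps_connected_sym eps_connected_trans)+
        qed
      qed
    qed (use h t in auto)
    then have "conn h (T h) (T t)" by (simp add: eps_connected_refl)
    moreover have "c (u, v) = T h" using g by (simp add: c_def h_def)
    ultimately show ?thesis using conn_const_on_gap[OF g h t] by simp
  qed
  have conn_end: "conn r (T r) (c (u, v))" if g: "(u, v) \<in> gaps B" and r_end: "r = u \<or> r = v" for u v r
  proof -
    have r: "r \<in> {u..v}" using r_end gap_bounds[OF g] by auto
    have "\<forall>\<^sub>F s in at r within {t0..t1}. conn r (T r) (T s)"
      using trajectoid_eventually_connected[OF T] r gap_bounds[OF g] by auto
    moreover have "{u<..<v} \<subseteq> {t0..t1}" using gap_bounds[OF g] by auto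
    ultimately have "\<forall>\<^sub>F s in at r within {u<..<v}. conn r (T r) (T s)"
      using at_le filter_leD by blast
    moreover have "\<forall>\<^sub>F s in at r within {u<..<v}. s \<in> {u<..<v}"
      unfolding eventually_at by (auto intro: exI[of _ 1])
    ultimately have "\<forall>\<^sub>F s in at r within {u<..<v}. s \<in> {u<..<v} \<and> conn r (T r) (T s)"
      by eventually_elim auto
    \<comment> \<open>An end of the window is a limit point of it, so the eventual statement yields
      an actual time \<open>s\<close> inside the window.\<close>
    moreover have "at r within {u<..<v} \<noteq> bot"
      using gap_bounds[OF g] r_end islimpt_greaterThanLessThan1 islimpt_greaterThanLessThan2
      by (auto simp: trivial_limit_within)
    ultimately obtain s where s: "s \<in> {u<..<v}" "conn r (T r) (T s)"
      using eventually_happens' by blast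
    have "conn r (c (u, v)) (T s)"
      using conn_extends_to_closed_gap[OF g s(1) r conn_c[OF g s(1)]] .
    then show ?thesis using s(2) eps_connected_sym eps_connected_trans by blast
  qed
  have "selection c"
    unfolding selection_def
  proof (intro conjI ballI allI impI)
    fix g assume "g \<in> gaps B"
    then show "c g < n"
      using T gap_bounds[of "fst g" "snd g"] by (auto simp: c_def trajectoid_def)
  next
    fix u v w assume "(u, v) \<in> gaps B" "(v, w) \<in> gaps B"
    then have "conn v (T v) (c (u, v))" "conn v (T v) (c (v, w))"
      using conn_end gap_bounds by force+
    then show "conn v (c (u, v)) (c (v, w))"
      using eps_connected_sym eps_connected_trans by blast
  qed
  then show thesis using that conn_c by (simp add: c_def)
qed

text \<open>In each window the component named by \<open>c\<close> gets its own envelope;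
  \<open>F\<close> adds the resulting breakpoints to \<open>B\<close>, so on every gap of
  \<open>F\<close> a single entity is optimal within its component.\<close>

lemma selection_envelope:
  assumes "selection c"
  obtains F where "finite F" "B \<subseteq> F" "F \<subseteq> {t0..t1}"
    "real (card F) \<le> 90 * real tau * real n powr (5/2)"
    "\<And>x y. (x, y) \<in> gaps F \<Longrightarrow> \<exists>i<n. \<exists>u v. (u, v) \<in> gaps B \<and> u \<le> x \<and> y \<le> v \<and>
       (\<forall>t\<in>{x<..<y}. conn t (c (u, v)) i \<and> (\<forall>k<n. conn t (c (u, v)) k \<longrightarrow> D i t \<le> D k t))"
proof -
  \<comment> \<open>The component is read off at the midpoint, which represents the whole open
    window because connectivity is constant there.\<close>
  define C where "C = (\<lambda>(u, v). {k. k < n \<and> conn ((u + v) / 2) (c (u, v)) k})"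
  have ex: "\<exists>E d. finite E \<and> card E \<le> 2 * d \<and>
    d * (d - 1) \<le> (\<Sum>i<n. \<Sum>k<n. card (Z i k \<inter> {fst g<..<snd g})) \<and>
    (\<forall>x y. x < y \<longrightarrow> {x<..<y} \<subseteq> {fst g<..<snd g} \<longrightarrow> {x<..<y} \<inter> E = {} \<longrightarrow>
       (\<exists>i\<in>C g. \<forall>t\<in>{x<..<y}. \<forall>k\<in>C g. D i t \<le> D k t))" (is "\<exists>E d. ?P g E d") if "g \<in> gaps B" for g
  proof -
    obtain u v where g: "g = (u, v)" by fastforce
    have "c g \<in> C g" using assms that by (auto simp: C_def selection_def g eps_connected_refl)
    then have C: "C g \<subseteq> {..<n}" "C g \<noteq> {}" by (auto simp: C_def g)
    show ?thesis
    proof (rule gap_envelope[OF that[unfolded g] C])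
      fix E d assume "finite E" "card E \<le> 2 * d"
        "d * (d - 1) \<le> (\<Sum>i<n. \<Sum>k<n. card (Z i k \<inter> {u<..<v}))"
        "\<And>x y. \<lbrakk>x < y; {x<..<y} \<subseteq> {u<..<v}; {x<..<y} \<inter> E = {}\<rbrakk> \<Longrightarrow>
           \<exists>i\<in>C g. \<forall>t\<in>{x<..<y}. \<forall>k\<in>C g. D i t \<le> D k t"
      then show ?thesis unfolding g fst_conv snd_conv by (intro exI[of _ E] exI[of _ d]) simp
    qed
  qed
  define E where "E g = (SOME E. \<exists>d. ?P g E d)" for g
  have "\<exists>d. ?P g (E g) d" if "g \<in> gaps B" for g
    unfolding E_def using someI_ex[OF ex[OF that]] .
  then obtain d where Ed: "\<And>g. g \<in> gaps B \<Longrightarrow> ?P g (E g) (d g)"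
    using bchoice[of "gaps B" "\<lambda>g d. ?P g (E g) d"] by blast
  \<comment> \<open>Points of \<open>E g\<close> outside their own window are discarded; this keeps
    \<open>F\<close> inside \<open>{t0..t1}\<close>.\<close>
  define F where "F = B \<union> (\<Union>g\<in>gaps B. E g \<inter> {fst g<..<snd g})"
  have fin: "finite F" using finite_B finite_gaps Ed by (auto simp: F_def)
  show thesis
  proof (rule that[of F])
    show "finite F" "B \<subseteq> F" using fin by (auto simp: F_def)
    show sub: "F \<subseteq> {t0..t1}"
      using B_subset gap_bounds by (force simp: F_def)
    have "card F \<le> card B + card (\<Union>g\<in>gaps B. E g \<inter> {fst g<..<snd g})"
      unfolding F_def by (rule card_Un_le)
    also have "card (\<Union>g\<in>gaps B. E g \<inter> {fst g<..<snd g}) \<le> (\<Sum>g\<in>gaps B. card (E g \<inter> {fst g<..<snd g}))"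
      by (rule card_UN_le[OF finite_gaps[OF finite_B]])
    also have "\<dots> \<le> (\<Sum>g\<in>gaps B. 2 * d g)"
    proof (rule sum_mono)
      fix g assume "g \<in> gaps B"
      then have "finite (E g)" "card (E g) \<le> 2 * d g" using Ed by blast+
      then show "card (E g \<inter> {fst g<..<snd g}) \<le> 2 * d g"
        using card_mono[of "E g" "E g \<inter> {fst g<..<snd g}"] by simp
    qed
    also have "\<dots> = 2 * (\<Sum>g\<in>gaps B. d g)" by (simp add: sum_distrib_left)
    finally have "card F \<le> card B + 2 * (\<Sum>g\<in>gaps B. d g)" by simp
    then have "real (card F) \<le> real (card B + 2 * (\<Sum>g\<in>gaps B. d g))" by (rule of_nat_mono)
    also have "\<dots> = real (card B) + 2 * real (\<Sum>g\<in>gaps B. d g)" by simp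
    \<comment> \<open>The points of \<open>B\<close> contribute 6, by
      \<open>n powr 2 \<le> n powr (5/2)\<close>; each unit of \<open>d\<close> allows two
      breakpoints, hence \<open>2 * 42\<close>. The total is 90.\<close>
    also have "\<dots> \<le> 6 * real tau * real n powr (5/2) + 2 * (42 * real tau * real n powr (5/2))"
    proof (intro add_mono mult_left_mono)
      show "real (\<Sum>g\<in>gaps B. d g) \<le> 42 * real tau * real n powr (5/2)"
      proof (rule sum_gap_sizes_le)
        fix u v assume "(u, v) \<in> gaps B"
        from Ed[OF this] show "d (u, v) * (d (u, v) - 1) \<le> (\<Sum>i<n. \<Sum>k<n. card (Z i k \<inter> {u<..<v}))"
          by simp
      qed
      have "real (card B) \<le> real (6 * tau * n\<^sup>2)" using card_B by (rule of_nat_mono)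
      also have "\<dots> = 6 * real tau * real n powr 2" using n_pos by simp
      also have "\<dots> \<le> 6 * real tau * real n powr (5/2)"
        using n_pos by (intro mult_left_mono powr_mono) auto
      finally show "real (card B) \<le> 6 * real tau * real n powr (5/2)" .
    qed simp
    finally show "real (card F) \<le> 90 * real tau * real n powr (5/2)" by simp
    fix x y assume xy: "(x, y) \<in> gaps F"
    have "t0 \<le> x" "x < y" "y \<le> t1" using gapsD[OF xy] sub by auto
    moreover have "B \<inter> {x<..<y} = {}" using gapsD(4)[OF xy] by (auto simp: F_def)
    ultimately obtain u v where g: "(u, v) \<in> gaps B" "u \<le> x" "y \<le> v"
      using gap_containing[OF finite_B ends_in_B, of x y] by blast
    have uv: "{x<..<y} \<subseteq> {u<..<v}" using g by auto
    have "E (u, v) \<inter> {u<..<v} \<subseteq> F" using g(1) by (force simp: F_def)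
    then have "{x<..<y} \<inter> E (u, v) = {}" using gapsD(4)[OF xy] uv by blast
    then obtain i where i: "i \<in> C (u, v)" "\<forall>t\<in>{x<..<y}. \<forall>k\<in>C (u, v). D i t \<le> D k t"
      using Ed[OF g(1)] \<open>x < y\<close> uv unfolding fst_conv snd_conv by blast
    have mid: "(u + v) / 2 \<in> {u<..<v}" using gap_bounds[OF g(1)] by auto
    have "i < n" using i(1) by (simp add: C_def)
    moreover have "k \<in> C (u, v) \<longleftrightarrow> k < n \<and> conn t (c (u, v)) k" if "t \<in> {x<..<y}" for t k
      using conn_const_on_gap[OF g(1) mid, of t] that uv by (auto simp: C_def)
    ultimately show "\<exists>i<n. \<exists>u v. (u, v) \<in> gaps B \<and> u \<le> x \<and> y \<le> v \<and>
       (\<forall>t\<in>{x<..<y}. conn t (c (u, v)) i \<and> (\<forall>k<n. conn t (c (u, v)) k \<longrightarrow> D i t \<le> D k t))"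
      using i g by blast
  qed
qed

text \<open>The trajectoid follows the envelope entity on each gap of \<open>F\<close>. Optimality
  is claimed only off \<open>F\<close>, because at a breakpoint the value is merely inherited from
  an adjacent piece.\<close>

lemma selection_trajectoid:
  assumes c: "selection c"
  obtains T m F where "trajectoid n X eps t0 t1 T" "complexity_le X t0 t1 T m"
    "real m \<le> 90 * real tau * real n powr (5/2)" "(\<lambda>t. D (T t) t) integrable_on {t0..t1}"
    "finite F" "B \<subseteq> F"
    "\<And>u v t k. \<lbrakk>(u, v) \<in> gaps B; t \<in> {u<..<v}; t \<notin> F; k < n; conn t (c (u, v)) k\<rbrakk> \<Longrightarrow>
       D (T t) t \<le> D k t"
proof -
  obtain F where F: "finite F" "B \<subseteq> F" "F \<subseteq> {t0..t1}"
    "real (card F) \<le> 90 * real tau * real n powr (5/2)"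
    "\<And>x y. (x, y) \<in> gaps F \<Longrightarrow> \<exists>i<n. \<exists>u v. (u, v) \<in> gaps B \<and> u \<le> x \<and> y \<le> v \<and>
       (\<forall>t\<in>{x<..<y}. conn t (c (u, v)) i \<and> (\<forall>k<n. conn t (c (u, v)) k \<longrightarrow> D i t \<le> D k t))"
    by (rule selection_envelope[OF c]) blast
  obtain s m where s: "s 0 = t0" "s m = t1" "m < card F" "\<And>i. i < m \<Longrightarrow> (s i, s (Suc i)) \<in> gaps F"
    using gaps_enumerate[of F t0 t1] F(1-3) ends_in_B t0_less_t1 by blast
  define fits where "fits x y i u v \<longleftrightarrow> i < n \<and> (u, v) \<in> gaps B \<and> u \<le> x \<and> y \<le> v \<and>
       (\<forall>t\<in>{x<..<y}. conn t (c (u, v)) i \<and> (\<forall>k<n. conn t (c (u, v)) k \<longrightarrow> D i t \<le> D k t))" for x y i u v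
  have "\<exists>i u v. fits (s j) (s (Suc j)) i u v" if "j < m" for j
    using F(5)[OF s(4)[OF that]] unfolding fits_def by blast
  then obtain e u v where euv: "\<And>j. j < m \<Longrightarrow> fits (s j) (s (Suc j)) (e j) (u j) (v j)"
    by metis
  have e: "e j < n" "(u j, v j) \<in> gaps B" "u j \<le> s j" "s (Suc j) \<le> v j" if "j < m" for j
    using euv[OF that] by (auto simp: fits_def)
  have e_min: "conn t (c (u j, v j)) (e j)" "\<And>k. k < n \<Longrightarrow> conn t (c (u j, v j)) k \<Longrightarrow> D (e j) t \<le> D k t"
    if "j < m" "t \<in> {s j<..<s (Suc j)}" for j t
    using euv[OF that(1)] that(2) by (auto simp: fits_def)
  have s_Suc: "s j < s (Suc j)" if "j < m" for j using gapsD(3)[OF s(4)[OF that]] .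
  have s_mono: "s i \<le> s j" if "i \<le> j" "j \<le> m" for i j
    using that
  proof (induction j rule: dec_induct)
    case (step j)
    then show ?case using s_Suc[of j] by auto
  qed simp
  have m_pos: "m > 0" using s(1,2) t0_less_t1 by (cases m) auto
  \<comment> \<open>Pieces are closed on the right: a breakpoint keeps the entity of the piece
    ending there, and \<open>t0\<close> gets that of piece 0.\<close>
  define idx where "idx t = (LEAST j. t \<le> s (Suc j))" for t
  define T where "T t = e (idx t)" for t
  have idx: "idx t < m" "s (idx t) \<le> t" "t \<le> s (Suc (idx t))" if "t \<in> {t0..t1}" for t
  proof -
    have *: "t \<le> s (Suc (m - 1))" using that s(2) m_pos by simp
    show "t \<le> s (Suc (idx t))" unfolding idx_def by (rule LeastI[of "\<lambda>j. t \<le> s (Suc j)", OF *])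
    have "idx t \<le> m - 1" unfolding idx_def by (rule Least_le[of "\<lambda>j. t \<le> s (Suc j)", OF *])
    then show "idx t < m" using m_pos by simp
    show "s (idx t) \<le> t"
    proof (cases "idx t")
      case 0
      then show ?thesis using that s(1) by simp
    next
      case (Suc j)
      then have "\<not> t \<le> s (Suc j)" using not_less_Least[of j "\<lambda>j. t \<le> s (Suc j)"] by (simp add: idx_def)
      then show ?thesis using Suc by simp
    qed
  qed
  have idx_eq: "idx t = j" if "j < m" "s j < t" "t \<le> s (Suc j)" for j t
    unfolding idx_def
  proof (rule Least_equality)
    fix i assume "t \<le> s (Suc i)"
    then show "j \<le> i" using s_mono[of "Suc i" j] that by (cases "j \<le> i") auto
  qed (rule that)
  have closed_conn: "conn t (c (u j, v j)) (e j)" if j: "j < m" and t: "t \<in> {s j..s (Suc j)}" for j t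
  proof -
    define h where "h = (s j + s (Suc j)) / 2"
    have h: "h \<in> {s j<..<s (Suc j)}" using s_Suc[OF j] by (auto simp: h_def)
    have "h \<in> {u j<..<v j}" "t \<in> {u j..v j}" using h t e(3,4)[OF j] by auto
    then show ?thesis using conn_extends_to_closed_gap[OF e(2)[OF j]] e_min(1)[OF j h] by blast
  qed
  show thesis
  proof (rule that[of T m F])
    show "trajectoid n X eps t0 t1 T"
      unfolding trajectoid_def
    proof (intro conjI ballI allI impI)
      fix t assume "t \<in> {t0..t1}"
      then show "T t < n" using idx e(1) by (simp add: T_def)
    next
      fix t k assume t: "t \<in> {t0..t1}" and k: "\<forall>\<delta>>0. \<exists>r\<in>{t0..t1}. \<bar>r - t\<bar> < \<delta> \<and> T r = k"
      \<comment> \<open>\<open>?K\<close> is the closed union of the pieces on which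
        \<open>k\<close> is followed. Since \<open>k\<close> is attained arbitrarily close to
        \<open>t\<close>, closedness forces \<open>t\<close> into it, so some piece of
        \<open>k\<close> touches \<open>t\<close>.\<close>
      let ?K = "\<Union>j\<in>{j. j < m \<and> e j = k}. {s j..s (Suc j)}"
      have "t \<in> ?K"
      proof (rule ccontr)
        assume "t \<notin> ?K"
        then have "t \<in> - ?K" by blast
        moreover have "open (- ?K)" by (intro open_Compl closed_UN) auto
        ultimately obtain d where d: "d > 0" "ball t d \<subseteq> - ?K" using openE by blast
        obtain r where r: "r \<in> {t0..t1}" "\<bar>r - t\<bar> < d" "T r = k" using k d(1) by blast
        have "r \<in> ?K" using idx[OF r(1)] r(3) by (auto simp: T_def)
        moreover have "r \<in> ball t d" using r(2) by (simp add: dist_real_def)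
        ultimately show False using d(2) by blast
      qed
      then obtain j where j: "j < m" "e j = k" "t \<in> {s j..s (Suc j)}" by blast
      define i where "i = idx t"
      have i: "i < m" "t \<in> {s i..s (Suc i)}" using idx[OF t] by (auto simp: i_def)
      have tt: "t \<in> {u i..v i}" "t \<in> {u j..v j}"
        using e(3,4)[OF i(1)] e(3,4)[OF j(1)] i(2) j(3) by auto
      \<comment> \<open>The piece of \<open>t\<close> and the piece of \<open>k\<close> lie in equal
        or adjacent windows; in the adjacent case \<open>selection\<close> connects the
        representatives at the common cut point.\<close>
      have "conn t (c (u i, v i)) (c (u j, v j))"
        using gaps_touch[OF e(2)[OF i(1)] e(2)[OF j(1)] tt]
      proof (elim disjE)
        assume "(u i, v i) = (u j, v j)"
        then show ?thesis by (simp add: eps_connected_refl)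
      next
        assume "t = v i \<and> t = u j"
        then have eq: "v i = t" "u j = t" by auto
        show ?thesis using c e(2)[OF i(1)] e(2)[OF j(1)] unfolding selection_def eq by blast
      next
        assume "t = u i \<and> t = v j"
        then have eq: "u i = t" "v j = t" by auto
        have "conn t (c (u j, v j)) (c (u i, v i))"
          using c e(2)[OF i(1)] e(2)[OF j(1)] unfolding selection_def eq by blast
        then show ?thesis by (rule eps_connected_sym)
      qed
      then have "conn t (e i) (e j)"
        using eps_connected_trans[OF eps_connected_sym[OF closed_conn[OF i]]]
          eps_connected_trans[OF _ closed_conn[OF j(1,3)]] by blast
      then show "conn t (T t) k" by (simp add: T_def i_def j(2))
    qed
    have T_gap: "T t = e j" if "j < m" "t \<in> {s j<..<s (Suc j)}" for j t
      using idx_eq[of j t] that by (simp add: T_def)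
    have T_end: "T (s (Suc j)) = e j" if "j < m" for j
      using idx_eq[OF that s_Suc[OF that]] by (simp add: T_def)
    have lin: "\<exists>a b. \<forall>t\<in>{s j..s (Suc j)}. X (e j) t = a + t *\<^sub>R b" if j: "j < m" for j
    proof -
      obtain a b where "\<forall>t\<in>{u j..v j}. X (e j) t = a + t *\<^sub>R b"
        using gap_piece_linear[OF e(2)[OF j] e(1)[OF j]] by blast
      then show ?thesis using e(3,4)[OF j] by (intro exI[of _ a] exI[of _ b]) auto
    qed
    have T0: "T (s 0) = e 0"
    proof -
      have "s 0 \<le> s (Suc 0)" using s_Suc[OF m_pos] by simp
      then have "idx (s 0) = 0" unfolding idx_def by (rule Least_eq_0)
      then show ?thesis by (simp add: T_def)
    qed
    show "complexity_le X t0 t1 T m"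
      unfolding complexity_le_def
    proof (intro exI[of _ s] exI[of _ e] conjI)
      show "T (s m) = e (m - 1)" using T_end[of "m - 1"] m_pos by simp
      show "\<forall>i. 0 < i \<and> i < m \<longrightarrow> T (s i) = e (i - 1) \<or> T (s i) = e i"
      proof (intro allI impI)
        fix i assume "0 < i \<and> i < m"
        then have "i - 1 < m" "Suc (i - 1) = i" by auto
        then show "T (s i) = e (i - 1) \<or> T (s i) = e i" using T_end[of "i - 1"] by simp
      qed
      show "\<forall>i<m. \<forall>t\<in>{s i<..<s (Suc i)}. T t = e i" using T_gap by blast
      show "\<forall>i<m. \<exists>a b. \<forall>t\<in>{s i..s (Suc i)}. X (e i) t = a + t *\<^sub>R b"
        using lin by (intro allI impI)
    qed (use s(1,2) s_Suc T0 in simp_all)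
    show "real m \<le> 90 * real tau * real n powr (5/2)" using s(3) F(4) by linarith
    have "(\<lambda>t. D (T t) t) integrable_on {s 0..s j}" if "j \<le> m" for j
      using that
    proof (induction j)
      case 0
      show ?case by (rule integrable_on_refl[of _ "s 0", unfolded box_real])
    next
      case (Suc j)
      then have j: "j < m" by simp
      have "{s j..s (Suc j)} \<subseteq> {t0..t1}"
        using s_mono[of 0 j] s_mono[of "Suc j" m] j s(1,2) by auto
      then have "D (e j) integrable_on {s j..s (Suc j)}"
        using continuous_on_subset[OF continuous_on_D[OF e(1)[OF j]]] integrable_continuous_real by blast
      then have "(\<lambda>t. D (T t) t) integrable_on {s j..s (Suc j)}"
        by (rule integrable_spike_finite[of "{s j, s (Suc j)}", rotated 2]) (use T_gap[OF j] in auto)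
      moreover have "(\<lambda>t. D (T t) t) integrable_on {s 0..s j}" using Suc j by simp
      moreover have "s 0 \<le> s j" "s j \<le> s (Suc j)" using s_mono[of 0 j] s_Suc[OF j] j by auto
      ultimately show ?case
        using Henstock_Kurzweil_Integration.integrable_combine by blast
    qed
    then show "(\<lambda>t. D (T t) t) integrable_on {t0..t1}" using s(1,2) by force
    show "finite F" "B \<subseteq> F" using F by auto
    fix u' v' t k assume g: "(u', v') \<in> gaps B" and t: "t \<in> {u'<..<v'}" "t \<notin> F"
      and k: "k < n" "conn t (c (u', v')) k"
    have "t \<in> {t0..t1}" using gap_bounds[OF g] t by auto
    note idx = idx[OF this]
    have "s (idx t) \<in> F" "s (Suc (idx t)) \<in> F" using gapsD[OF s(4)[OF idx(1)]] by auto
    then have tj: "t \<in> {s (idx t)<..<s (Suc (idx t))}" using idx t(2) by (metis greaterThanLessThan_iff order_le_less)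
    then have "t \<in> {u (idx t)<..<v (idx t)}" using e(3,4)[OF idx(1)] by auto
    then have "(u', v') = (u (idx t), v (idx t))"
      using gaps_overlap[OF g e(2)[OF idx(1)] t(1)] by blast
    then show "D (T t) t \<le> D k t"
      using e_min(2)[OF idx(1) tj k(1)] k(2) by (simp add: T_def)
  qed
qed

text \<open>Every competitor induces a selection, and the envelope trajectoid of that selection
  costs no more. There are finitely many extensional selections, so the cheapest of their
  trajectoids is a minimiser.\<close>

lemma central_trajectory_exists:
  "\<exists>T m. central_trajectory n X eps t0 t1 T \<and> complexity_le X t0 t1 T m \<and>
     real m \<le> 90 * real tau * real n powr (5/2)"
proof -
  define cost where "cost T = integral {t0..t1} (\<lambda>t. D (T t) t)" for T
  define good where "good c T \<longleftrightarrow> trajectoid n X eps t0 t1 T \<and>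
      (\<exists>m. complexity_le X t0 t1 T m \<and> real m \<le> 90 * real tau * real n powr (5/2)) \<and>
      (\<lambda>t. D (T t) t) integrable_on {t0..t1} \<and>
      (\<exists>F. finite F \<and> B \<subseteq> F \<and> (\<forall>u v t k. (u, v) \<in> gaps B \<longrightarrow> t \<in> {u<..<v} \<longrightarrow> t \<notin> F \<longrightarrow> k < n \<longrightarrow>
         conn t (c (u, v)) k \<longrightarrow> D (T t) t \<le> D k t))" for c T
  have "\<exists>T. good c T" if "selection c" for c
  proof (rule selection_trajectoid[OF that])
    fix T m F
    assume T: "trajectoid n X eps t0 t1 T" "complexity_le X t0 t1 T m"
      "real m \<le> 90 * real tau * real n powr (5/2)" "(\<lambda>t. D (T t) t) integrable_on {t0..t1}"
      and F: "finite F" "B \<subseteq> F"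
        "\<And>u v t k. \<lbrakk>(u, v) \<in> gaps B; t \<in> {u<..<v}; t \<notin> F; k < n; conn t (c (u, v)) k\<rbrakk> \<Longrightarrow>
           D (T t) t \<le> D k t"
    have "good c T"
      unfolding good_def
      by (intro conjI exI[of _ m] exI[of _ F] allI impI T F(1,2)) (rule F(3))
    then show ?thesis by blast
  qed
  then obtain Tr where Tr: "\<And>c. selection c \<Longrightarrow> good c (Tr c)" by metis
  define Sel where "Sel = {c. selection c \<and> c \<in> extensional (gaps B)}"
  have "Sel \<subseteq> gaps B \<rightarrow>\<^sub>E {..<n}" by (auto simp: Sel_def selection_def PiE_def)
  moreover have "finite (gaps B \<rightarrow>\<^sub>E {..<n})" using finite_gaps[OF finite_B] by (intro finite_PiE) auto
  ultimately have "finite Sel" by (rule finite_subset)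
  \<comment> \<open>Staying with entity 0 throughout shows that \<open>Sel\<close> is
    nonempty.\<close>
  moreover have "(\<lambda>g\<in>gaps B. 0) \<in> Sel"
    using n_pos by (auto simp: Sel_def selection_def eps_connected_refl)
  ultimately obtain c where c: "c \<in> Sel" "\<And>c'. c' \<in> Sel \<Longrightarrow> cost (Tr c) \<le> cost (Tr c')"
    using ex_is_arg_min_if_finite[of Sel "\<lambda>c. cost (Tr c)"] by (auto simp: is_arg_min_linorder)
  have good: "good c (Tr c)" using c(1) Tr by (simp add: Sel_def)
  have "cost (Tr c) \<le> cost T'"
    if T': "trajectoid n X eps t0 t1 T'" "(\<lambda>t. D (T' t) t) integrable_on {t0..t1}" for T'
  proof -
    obtain c' where c': "selection c'" "c' \<in> extensional (gaps B)"
      "\<And>u v t. (u, v) \<in> gaps B \<Longrightarrow> t \<in> {u<..<v} \<Longrightarrow> conn t (c' (u, v)) (T' t)"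
      using trajectoid_selection[OF T'(1)] by blast
    obtain F where F: "finite F" "B \<subseteq> F"
      "\<And>u v t k. \<lbrakk>(u, v) \<in> gaps B; t \<in> {u<..<v}; t \<notin> F; k < n; conn t (c' (u, v)) k\<rbrakk> \<Longrightarrow>
         D (Tr c' t) t \<le> D k t"
      using Tr[OF c'(1)] unfolding good_def by blast
    have "cost (Tr c) \<le> cost (Tr c')" using c(2) c'(1,2) by (simp add: Sel_def)
    also have "\<dots> \<le> cost T'"
      unfolding cost_def
    proof (rule integral_le_off_finite[OF F(1) _ T'(2)])
      show "(\<lambda>t. D (Tr c' t) t) integrable_on {t0..t1}" using Tr[OF c'(1)] by (simp add: good_def)
      fix t assume t: "t \<in> {t0..t1} - F"
      have "t \<notin> B" using t F(2) by blast
      \<comment> \<open>\<open>gap_containing\<close> asks for a nondegenerate interval, so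
        \<open>t\<close> is joined to the last cut point before it.\<close>
      define x where "x = Max {b \<in> B. b \<le> t}"
      have "x \<in> {b \<in> B. b \<le> t}"
        unfolding x_def using finite_B ends_in_B t by (intro Max_in) auto
      then have x: "x \<in> B" "x < t" using \<open>t \<notin> B\<close> by (auto simp: order_le_less)
      have "b \<le> x" if "b \<in> B" "b \<le> t" for b
        unfolding x_def using finite_B that by (intro Max_ge) auto
      then have disj: "B \<inter> {x<..<t} = {}" by force
      have "t0 \<le> x" "t \<le> t1" using x(1) B_subset t by auto
      then obtain u v where g: "(u, v) \<in> gaps B" "u \<le> x" "t \<le> v"
        using gap_containing[OF finite_B ends_in_B _ x(2) _ disj] by blast
      have "t \<noteq> v" using gapsD(2)[OF g(1)] \<open>t \<notin> B\<close> by blast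
      then have tg: "t \<in> {u<..<v}" using g x by auto
      show "D (Tr c' t) t \<le> D (T' t) t"
        using F(3)[OF g(1) tg] c'(3)[OF g(1) tg] T'(1) t by (auto simp: trajectoid_def)
    qed
    finally show ?thesis .
  qed
  then have "central_trajectory n X eps t0 t1 (Tr c)"
    using good by (simp add: central_trajectory_def good_def cost_def)
  then show ?thesis using good by (auto simp: good_def)
qed

end

theorem mainTheorem14:
  shows "\<exists>C::real. \<forall>(n::nat) (tau::nat) (tm::nat \<Rightarrow> real) (X::nat \<Rightarrow> real \<Rightarrow> 'a::euclidean_space) (eps::real).
     n \<ge> 1 \<and> tau \<ge> 1 \<and> strict_mono_on {0..tau} tm \<and> eps > 0 \<and>
     piecewise_linear_trajs n tau tm X \<and>
     general_position n X eps (tm 0) (tm tau) \<longrightarrow>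
     (\<exists>T m. central_trajectory n X eps (tm 0) (tm tau) T \<and>
            complexity_le X (tm 0) (tm tau) T m \<and>
            real m \<le> C * real tau * real n powr (5/2))"
\<comment> \<open>The constant is the same for every dimension.\<close>
proof (intro exI[of _ 90] allI impI)
  fix n tau :: nat and tm :: "nat \<Rightarrow> real" and X :: "nat \<Rightarrow> real \<Rightarrow> 'a" and eps :: real
  assume "n \<ge> 1 \<and> tau \<ge> 1 \<and> strict_mono_on {0..tau} tm \<and> eps > 0 \<and>
     piecewise_linear_trajs n tau tm X \<and> general_position n X eps (tm 0) (tm tau)"
  then interpret linear_motion n tau tm X eps by unfold_locales auto
  obtain B Z where "motion_windows n tau tm X eps B Z"
  proof (rule windows_exist)
    fix B Z
    assume "finite B" "vertices \<subseteq> B" "B \<subseteq> {t0..t1}" "card B \<le> 6 * tau * n\<^sup>2"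
      "\<And>u v i. (u, v) \<in> gaps B \<Longrightarrow> i < n \<Longrightarrow> quadratic_on {u<..<v} (\<lambda>t. (D i t)\<^sup>2)"
      "\<And>u v i k s t. \<lbrakk>(u, v) \<in> gaps B; i < n; k < n; s \<in> {u<..<v}; t \<in> {u<..<v};
         dist (X i s) (X k s) \<le> eps\<rbrakk> \<Longrightarrow> dist (X i t) (X k t) \<le> eps"
      "\<And>i k. i < n \<Longrightarrow> k < n \<Longrightarrow> finite (Z i k) \<and> card (Z i k) \<le> 30 * n * tau"
      "\<And>i k. i < n \<Longrightarrow> k < n \<Longrightarrow> separates_crossings t0 t1 (Z i k) (D i) (D k)"
    then have "motion_windows n tau tm X eps B Z" by unfold_locales
    then show thesis by (rule that)
  qed
  then interpret motion_windows n tau tm X eps B Z .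
  show "\<exists>T m. central_trajectory n X eps t0 t1 T \<and> complexity_le X t0 t1 T m \<and>
      real m \<le> 90 * real tau * real n powr (5/2)"
    by (rule central_trajectory_exists)
qed

end
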